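(* Let $d\ge1$ and let $(G_n)_n$ be a sequence of finite connected graphs with $|G_n|\to\infty$, maximal degree at most $d$, and spectral gap $1-\lambda$ of the (lazy) simple random walk bounded below by a positive constant uniformly in $n$. For each $n$ let $s,e\in G_n$ be vertices with $\mathrm{dist}(s,e)=\mathrm{diam}(G_n)$, and run DLA on $G_n$ from $s$ to $e$. Then there is a constant $c>0$, independent of $n$, such that with probability tending to $1$ as $n\to\infty$ the final aggregate $A_\tau$ contains at least $|G_n|^c$ particles.
   Context: Simple random walk on a graph has $P(x,y)=\mathbf 1\{x\sim y\}/\deg(x)$ and stationary measure $\pi(x)\propto\deg(x)$. For $S\subset G$, $T_S=\inf\{t\ge0:X_t\in S\}$, $\partial S=\{x\in S:\exists\,y\notin S,\ y\sim x\}$, and $h_S(x)=\sum_y\pi(y)\Pr_y[X_{T_S}=x]$ is the harmonic measure on $S$ from the stationary distribution. DLA on a finite graph $G$ with start and end vertices $s,e$ is the random process $\{s\}=A_0\subset A_1\subset\cdots$ in which, at each step $t\ge1$, a vertex $a_t$ is chosen with distribution $h_{\partial A_{t-1}}$ (the first point of $\partial A_{t-1}$ hit by a simple random walk started from $\pi$), independently given the past, and $A_t=A_{t-1}\cup\{a_t\}$; the process stops at $\tau=\inf\{t: e\in A_t\}$.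
   Formalization: The new particle is placed at the first vertex outside the aggregate adjacent to it (boundary of the complement G \ A) rather than in the inner boundary ∂A of A, since with the inner boundary as defined the aggregate would never grow and τ would be infinite. *)

theory Defs
  imports "HOL-Analysis.Analysis"
begin

definition simple_graph :: "'a set \<Rightarrow> ('a \<Rightarrow> 'a \<Rightarrow> bool) \<Rightarrow> bool" where
  "simple_graph V E \<longleftrightarrow> finite V \<and> (\<forall>x y. E x y \<longrightarrow> x \<in> V \<and> y \<in> V)
     \<and> (\<forall>x y. E x y \<longrightarrow> E y x) \<and> (\<forall>x. \<not> E x x)"

definition deg :: "'a set \<Rightarrow> ('a \<Rightarrow> 'a \<Rightarrow> bool) \<Rightarrow> 'a \<Rightarrow> nat" where
  "deg V E x = card {y \<in> V. E x y}"

fun reach :: "'a set \<Rightarrow> ('a \<Rightarrow> 'a \<Rightarrow> bool) \<Rightarrow> nat \<Rightarrow> 'a \<Rightarrow> 'a set" where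
  "reach V E 0 x = {x}"
| "reach V E (Suc k) x = reach V E k x \<union> {z \<in> V. \<exists>y \<in> reach V E k x. E y z}"

definition connected_graph :: "'a set \<Rightarrow> ('a \<Rightarrow> 'a \<Rightarrow> bool) \<Rightarrow> bool" where
  "connected_graph V E \<longleftrightarrow> V \<noteq> {} \<and> (\<forall>x\<in>V. \<forall>y\<in>V. \<exists>k. y \<in> reach V E k x)"

definition gdist :: "'a set \<Rightarrow> ('a \<Rightarrow> 'a \<Rightarrow> bool) \<Rightarrow> 'a \<Rightarrow> 'a \<Rightarrow> nat" where
  "gdist V E x y = (LEAST k. y \<in> reach V E k x)"

definition diam :: "'a set \<Rightarrow> ('a \<Rightarrow> 'a \<Rightarrow> bool) \<Rightarrow> nat" where
  "diam V E = Max {gdist V E x y | x y. x \<in> V \<and> y \<in> V}"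

definition srw :: "'a set \<Rightarrow> ('a \<Rightarrow> 'a \<Rightarrow> bool) \<Rightarrow> 'a \<Rightarrow> 'a \<Rightarrow> real" where
  "srw V E x y = (if E x y then 1 / real (deg V E x) else 0)"

definition lazy_srw :: "'a set \<Rightarrow> ('a \<Rightarrow> 'a \<Rightarrow> bool) \<Rightarrow> 'a \<Rightarrow> 'a \<Rightarrow> real" where
  "lazy_srw V E x y = (if x = y then 1/2 else 0) + srw V E x y / 2"

definition stat :: "'a set \<Rightarrow> ('a \<Rightarrow> 'a \<Rightarrow> bool) \<Rightarrow> 'a \<Rightarrow> real" where
  "stat V E x = real (deg V E x) / (\<Sum>z\<in>V. real (deg V E z))"

text \<open>Second eigenvalue of the lazy walk: the largest eigenvalue on the
  orthogonal complement (in L^2(pi)) of the constants; spectral gap = 1 - lambda.\<close>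
definition lazy_eigen_perp :: "'a set \<Rightarrow> ('a \<Rightarrow> 'a \<Rightarrow> bool) \<Rightarrow> real \<Rightarrow> bool" where
  "lazy_eigen_perp V E \<mu> \<longleftrightarrow> (\<exists>f. (\<exists>x\<in>V. f x \<noteq> 0) \<and> (\<Sum>x\<in>V. stat V E x * f x) = 0
      \<and> (\<forall>x\<in>V. (\<Sum>y\<in>V. lazy_srw V E x y * f y) = \<mu> * f x))"

definition spectral_gap :: "'a set \<Rightarrow> ('a \<Rightarrow> 'a \<Rightarrow> bool) \<Rightarrow> real" where
  "spectral_gap V E = 1 - Max {\<mu>. lazy_eigen_perp V E \<mu>}"

text \<open>hit_le V E S x t y = Pr_y[T_S \<le> t and X_{T_S} = x].\<close>
fun hit_le :: "'a set \<Rightarrow> ('a \<Rightarrow> 'a \<Rightarrow> bool) \<Rightarrow> 'a set \<Rightarrow> 'a \<Rightarrow> nat \<Rightarrow> 'a \<Rightarrow> real" where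
  "hit_le V E S x 0 y = (if y \<in> S \<and> y = x then 1 else 0)"
| "hit_le V E S x (Suc t) y =
     (if y \<in> S then (if y = x then 1 else 0)
      else (\<Sum>z\<in>V. srw V E y z * hit_le V E S x t z))"

definition hitprob :: "'a set \<Rightarrow> ('a \<Rightarrow> 'a \<Rightarrow> bool) \<Rightarrow> 'a set \<Rightarrow> 'a \<Rightarrow> 'a \<Rightarrow> real" where
  "hitprob V E S x y = lim (\<lambda>t. hit_le V E S x t y)"

definition harm :: "'a set \<Rightarrow> ('a \<Rightarrow> 'a \<Rightarrow> bool) \<Rightarrow> 'a set \<Rightarrow> 'a \<Rightarrow> real" where
  "harm V E S x = (\<Sum>y\<in>V. stat V E y * hitprob V E S x y)"

definition bdry :: "'a set \<Rightarrow> ('a \<Rightarrow> 'a \<Rightarrow> bool) \<Rightarrow> 'a set \<Rightarrow> 'a set" where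
  "bdry V E S = {x \<in> S. \<exists>y \<in> V. y \<notin> S \<and> E y x}"

text \<open>DLA: from aggregate A, the next particle is placed at x with probability
  harm V E (bdry V E (V - A)) x (first vertex outside A, adjacent to A, hit by a
  walk from pi).  dla_prob V E e Q k A = probability that the DLA process started
  from aggregate A stops (contains e) within k steps and its final aggregate
  satisfies Q.\<close>
fun dla_prob :: "'a set \<Rightarrow> ('a \<Rightarrow> 'a \<Rightarrow> bool) \<Rightarrow> 'a \<Rightarrow> ('a set \<Rightarrow> bool) \<Rightarrow> nat \<Rightarrow> 'a set \<Rightarrow> real" where
  "dla_prob V E e Q 0 A = (if e \<in> A \<and> Q A then 1 else 0)"
| "dla_prob V E e Q (Suc k) A =
     (if e \<in> A then (if Q A then 1 else 0)
      else (\<Sum>x\<in>bdry V E (V - A). harm V E (bdry V E (V - A)) x * dla_prob V E e Q k (insert x A)))"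

text \<open>Probability that the final aggregate A_tau of DLA from s to e satisfies Q
  (the process stops after at most card V steps).\<close>
definition dla_final_prob :: "'a set \<Rightarrow> ('a \<Rightarrow> 'a \<Rightarrow> bool) \<Rightarrow> 'a \<Rightarrow> 'a \<Rightarrow> ('a set \<Rightarrow> bool) \<Rightarrow> real" where
  "dla_final_prob V E s e Q = dla_prob V E e Q (card V) {s}"

end

(* The harmonic measure of a vertex on the outer boundary of an aggregate A is O(1/|A|) as long as
   |A|^2 <= |G|: by time reversal it is governed by the expected hitting time of A and its boundary,
   and the spectral gap bounds this time uniformly by O(log |G| + |G|/|A|).
   Let F(A) be the sum of 2^dist(s,y) over y in A.  A boundary vertex is one step further from s than
   some neighbour in A, so one step of DLA multiplies F by at most 1 + p/|A| on average, with p a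
   constant.  Hence the expectation of F is at most M^p when |A| = M, whereas F(A) >= 2^diam once e
   is in A.  As 2^diam is at least a power of |G|, stopping with |A| < |G|^c is unlikely for small c. *)

theory Submission
  imports Defs
begin

text \<open>The gap is given through eigenvalues, but the proof needs two quadratic-form
  inequalities: a Poincare inequality for \<open>P\<close>, and decay of the iterates of the lazy
  operator \<open>L\<close>. Both follow once the maximal Rayleigh quotient over mean-zero functions
  is shown to be an eigenvalue, which is done by compactness and a first variation rather than a
  full spectral decomposition. The Poincare inequality bounds the hitting time averaged over \<pi>;
  mixing makes this pointwise at the cost of a term of order log |G|. The condition |A|^2 <= |G|
  absorbs that term, because log |G| = O(|G|^(1/2)) = O(|G|/|A|), and it also makes \<pi>(A) =
  O(1/|A|). Ball growth gives |G| <= (d+1)^diam, hence 2^diam >= |G|^\<beta> with \<beta> = ln 2 /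
  ln (d+1). The growth factors 1 + p/j <= ((j+1)/j)^p telescope to |G|^(cp) up to size |G|^c, so c
  is taken with cp <= \<beta>/2.\<close>

lemma nonneg_quadratic_linear_coeff:
  fixes b c :: real
  assumes "\<And>t. 2 * t * b + t\<^sup>2 * c \<ge> 0"
  shows "b = 0"
proof (rule ccontr)
  assume "b \<noteq> 0"
  \<comment> \<open>For this \<open>t\<close> the linear term is -2 t^2 (|c| + 1), which outweighs
    the quadratic one for either sign of \<open>c\<close>.\<close>
  define t where "t = - b / (\<bar>c\<bar> + 1)"
  have p: "\<bar>c\<bar> + 1 > 0" by linarith
  have "t * (\<bar>c\<bar> + 1) = - b" unfolding t_def using p by simp
  then have b: "b = - t * (\<bar>c\<bar> + 1)" by simp
  have "t \<noteq> 0" using \<open>b \<noteq> 0\<close> b by auto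
  have "2 * t * b + t\<^sup>2 * c = t\<^sup>2 * (c - 2 * \<bar>c\<bar> - 2)"
    unfolding b by (simp add: algebra_simps power2_eq_square)
  also have "\<dots> < 0"
    using \<open>t \<noteq> 0\<close> by (intro mult_pos_neg) auto
  finally show False using assms[of t] by linarith
qed

section \<open>The reversible walk as a self-adjoint operator\<close>

locale finite_connected_graph =
  fixes V :: "'a set" and E :: "'a \<Rightarrow> 'a \<Rightarrow> bool"
  assumes graph: "simple_graph V E"
    and conn: "connected_graph V E"
    and card_ge_2: "card V \<ge> 2"
begin

lemma fin[simp]: "finite V"
  using graph by (simp add: simple_graph_def)

lemma E_sym: "E x y \<Longrightarrow> E y x"
  using graph by (auto simp: simple_graph_def)

lemma E_in: "E x y \<Longrightarrow> x \<in> V" "E x y \<Longrightarrow> y \<in> V"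
  using graph by (auto simp: simple_graph_def)

lemma reach_subset: "x \<in> V \<Longrightarrow> reach V E k x \<subseteq> V"
  by (induction k) auto

lemma reach_mono: "k \<le> l \<Longrightarrow> reach V E k x \<subseteq> reach V E l x"
  by (induction l rule: dec_induct) auto

text \<open>An isolated vertex reaches only itself, so connectedness would leave a one-vertex graph.
  Positive degrees make \<open>srw\<close> stochastic and \<open>stat\<close> positive.\<close>

lemma deg_pos:
  assumes "x \<in> V"
  shows "deg V E x \<ge> 1"
proof (rule ccontr)
  assume "\<not> deg V E x \<ge> 1"
  have none: "\<not> E x y" for y
  proof
    assume "E x y"
    then have "y \<in> {y \<in> V. E x y}" using E_in by auto
    then have "card {y \<in> V. E x y} > 0" by (auto simp: card_gt_0_iff)
    then show False using \<open>\<not> deg V E x \<ge> 1\<close> by (simp add: deg_def)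
  qed
  have r: "reach V E k x = {x}" for k
    by (induction k) (auto simp: none)
  have "V \<subseteq> {x}"
    using conn assms r by (fastforce simp: connected_graph_def)
  then have "card V \<le> card {x}" by (intro card_mono) auto
  then show False using card_ge_2 by simp
qed

abbreviation sd :: "'a \<Rightarrow> real" where "sd \<equiv> stat V E"

definition total_deg :: real where "total_deg = (\<Sum>z\<in>V. real (deg V E z))"

lemma card_le_total_deg: "real (card V) \<le> total_deg"
proof -
  have "(\<Sum>z\<in>V. 1) \<le> total_deg"
    unfolding total_deg_def by (intro sum_mono) (use deg_pos in force)
  then show ?thesis by simp
qed

lemma total_deg_pos: "total_deg > 0"
  using card_le_total_deg card_ge_2 by linarith

lemma sd_eq: "sd x = real (deg V E x) / total_deg"
  by (simp add: stat_def total_deg_def)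

lemma sd_pos: "x \<in> V \<Longrightarrow> sd x > 0"
  using deg_pos[of x] total_deg_pos by (simp add: sd_eq)

lemma sd_nonneg: "sd x \<ge> 0"
  using total_deg_pos by (simp add: sd_eq)

lemma sum_sd: "(\<Sum>x\<in>V. sd x) = 1"
  using total_deg_pos by (simp add: sd_eq sum_divide_distrib[symmetric] total_deg_def)

lemma srw_nonneg: "srw V E x y \<ge> 0"
  by (simp add: srw_def)

lemma sum_srw:
  assumes "x \<in> V"
  shows "(\<Sum>y\<in>V. srw V E x y) = 1"
proof -
  have "(\<Sum>y\<in>V. srw V E x y) = (\<Sum>y\<in>{y\<in>V. E x y}. 1 / real (deg V E x))"
    unfolding srw_def sum.inter_filter[OF fin] ..
  also have "\<dots> = real (deg V E x) * (1 / real (deg V E x))" by (simp add: deg_def)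
  also have "\<dots> = 1" using deg_pos[OF assms] by simp
  finally show ?thesis .
qed

lemma detailed_balance:
  assumes "x \<in> V" "y \<in> V"
  shows "sd x * srw V E x y = sd y * srw V E y x"
  using deg_pos[OF assms(1)] deg_pos[OF assms(2)] E_sym[of x y] E_sym[of y x]
  by (auto simp: srw_def sd_eq)

definition P :: "('a \<Rightarrow> real) \<Rightarrow> 'a \<Rightarrow> real" where
  "P f x = (\<Sum>y\<in>V. srw V E x y * f y)"

text \<open>The lazy walk as an operator. Hitting is defined with \<open>P\<close>, but decay is run
  with \<open>L\<close>: \<open>P\<close> has eigenvalue -1 on a bipartite graph, whereas
  \<open>L\<close> is positive semidefinite.\<close>

definition L :: "('a \<Rightarrow> real) \<Rightarrow> 'a \<Rightarrow> real" where
  "L f x = (f x + P f x) / 2"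

definition ip :: "('a \<Rightarrow> real) \<Rightarrow> ('a \<Rightarrow> real) \<Rightarrow> real" where
  "ip f g = (\<Sum>x\<in>V. sd x * f x * g x)"

definition mean :: "('a \<Rightarrow> real) \<Rightarrow> real" where
  "mean f = (\<Sum>x\<in>V. sd x * f x)"

lemma lazy_srw_sum:
  assumes "x \<in> V"
  shows "(\<Sum>y\<in>V. lazy_srw V E x y * f y) = L f x"
proof -
  have "(\<Sum>y\<in>V. lazy_srw V E x y * f y)
      = (\<Sum>y\<in>V. (if y = x then f y / 2 else 0)) + (\<Sum>y\<in>V. srw V E x y * f y) / 2"
    unfolding lazy_srw_def sum_divide_distrib sum.distrib[symmetric]
    by (intro sum.cong) (auto simp: algebra_simps)
  then show ?thesis using assms by (simp add: L_def P_def)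
qed

lemma P_add: "P (\<lambda>x. f x + g x) y = P f y + P g y"
  by (simp add: P_def algebra_simps sum.distrib)

lemma P_diff: "P (\<lambda>x. f x - g x) y = P f y - P g y"
  by (simp add: P_def algebra_simps sum_subtractf)

lemma P_scale: "P (\<lambda>x. c * f x) y = c * P f y"
  by (simp add: P_def algebra_simps sum_distrib_left)

lemma P_const: "y \<in> V \<Longrightarrow> P (\<lambda>x. c) y = c"
  by (simp add: P_def sum_distrib_right[symmetric] sum_srw)

lemma P_mono: "(\<And>x. x \<in> V \<Longrightarrow> f x \<le> g x) \<Longrightarrow> P f y \<le> P g y"
  unfolding P_def by (intro sum_mono mult_left_mono srw_nonneg)

lemma P_nonneg: "(\<And>x. x \<in> V \<Longrightarrow> 0 \<le> f x) \<Longrightarrow> 0 \<le> P f y"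
  unfolding P_def by (intro sum_nonneg mult_nonneg_nonneg srw_nonneg)

lemma ip_commute: "ip f g = ip g f"
  by (simp add: ip_def algebra_simps)

lemma ip_add: "ip (\<lambda>x. f x + g x) h = ip f h + ip g h"
  by (simp add: ip_def algebra_simps sum.distrib)

lemma ip_diff: "ip (\<lambda>x. f x - g x) h = ip f h - ip g h"
  by (simp add: ip_def algebra_simps sum_subtractf)

lemma ip_scale: "ip (\<lambda>x. c * f x) h = c * ip f h"
  by (simp add: ip_def algebra_simps sum_distrib_left)

lemma ip_add2: "ip h (\<lambda>x. f x + g x) = ip h f + ip h g"
  by (simp add: ip_def algebra_simps sum.distrib)

lemma ip_diff2: "ip h (\<lambda>x. f x - g x) = ip h f - ip h g"
  by (simp add: ip_def algebra_simps sum_subtractf)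

lemma ip_scale2: "ip h (\<lambda>x. c * f x) = c * ip h f"
  by (simp add: ip_def algebra_simps sum_distrib_left)

lemma ip_const: "ip f (\<lambda>x. c) = c * mean f"
  by (simp add: ip_def mean_def algebra_simps sum_distrib_left)

lemma ip_cong: "(\<And>x. x \<in> V \<Longrightarrow> f x = f' x) \<Longrightarrow> (\<And>x. x \<in> V \<Longrightarrow> g x = g' x) \<Longrightarrow> ip f g = ip f' g'"
  unfolding ip_def by (intro sum.cong) auto

lemma ip_nonneg: "ip f f \<ge> 0"
  unfolding ip_def by (intro sum_nonneg) (simp add: mult.assoc sd_nonneg)

text \<open>The passage from L^2(\<pi>) to single points: it bounds the coordinates on the unit
  sphere, and later turns L^2 decay into pointwise decay.\<close>

lemma point_le_ip:
  assumes "z \<in> V"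
  shows "sd z * (f z)\<^sup>2 \<le> ip f f"
  unfolding ip_def power2_eq_square mult.assoc[symmetric]
  by (rule member_le_sum[OF assms]) (auto simp: mult.assoc sd_nonneg)

lemma ip_eq_0: "ip f f = 0 \<Longrightarrow> x \<in> V \<Longrightarrow> f x = 0"
  using point_le_ip[of x f] sd_pos[of x]
  by (metis mult_pos_pos not_less zero_less_power2)

lemma P_adjoint: "ip (P f) g = ip f (P g)"
proof -
  have "ip (P f) g = (\<Sum>x\<in>V. \<Sum>y\<in>V. (sd x * srw V E x y) * (f y * g x))"
    by (simp add: ip_def P_def sum_distrib_left sum_distrib_right mult_ac)
  also have "\<dots> = (\<Sum>x\<in>V. \<Sum>y\<in>V. (sd y * srw V E y x) * (f y * g x))"
    by (intro sum.cong) (use detailed_balance in auto)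
  also have "\<dots> = (\<Sum>y\<in>V. \<Sum>x\<in>V. (sd y * srw V E y x) * (f y * g x))"
    by (rule sum.swap)
  also have "\<dots> = ip f (P g)"
    by (simp add: ip_def P_def sum_distrib_left mult_ac)
  finally show ?thesis .
qed

lemma mean_P: "mean (P f) = mean f"
proof -
  have "mean (P f) = ip f (P (\<lambda>x. 1))"
    using ip_const[of "P f" 1] by (simp add: P_adjoint)
  also have "\<dots> = ip f (\<lambda>x. 1)"
    by (rule ip_cong) (auto simp: P_const)
  finally show ?thesis by (simp add: ip_const)
qed

lemma mean_add: "mean (\<lambda>x. f x + g x) = mean f + mean g"
  by (simp add: mean_def algebra_simps sum.distrib)

lemma mean_diff: "mean (\<lambda>x. f x - g x) = mean f - mean g"
  by (simp add: mean_def algebra_simps sum_subtractf)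

lemma mean_scale: "mean (\<lambda>x. c * f x) = c * mean f"
  by (simp add: mean_def algebra_simps sum_distrib_left)

lemma mean_const: "mean (\<lambda>x. c) = c"
  by (simp add: mean_def sum_distrib_right[symmetric] sum_sd)

lemma L_alt: "L f = (\<lambda>x. (1/2) * (f x + P f x))"
  by (rule ext) (simp add: L_def)

lemma mean_L: "mean (L f) = mean f"
proof -
  have "mean (L f) = 1/2 * (mean f + mean f)"
    unfolding L_alt mean_scale mean_add mean_P ..
  then show ?thesis by simp
qed

lemma L_adjoint: "ip (L f) g = ip f (L g)"
  unfolding L_alt ip_scale ip_scale2 ip_add ip_add2 P_adjoint ..

lemma L_mono: "(\<And>x. x \<in> V \<Longrightarrow> f x \<le> g x) \<Longrightarrow> y \<in> V \<Longrightarrow> L f y \<le> L g y"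
  using P_mono[of f g y] by (simp add: L_def add_mono)

text \<open>Jensen for the one-step distribution (its variance of \<open>f\<close> is nonnegative),
  then stationarity of \<pi> applied to \<open>f\<close> squared.\<close>

lemma P_contraction: "ip (P f) (P f) \<le> ip f f"
proof -
  have jensen: "(P f x)\<^sup>2 \<le> P (\<lambda>y. (f y)\<^sup>2) x" if "x \<in> V" for x
  proof -
    have "0 \<le> P (\<lambda>y. (f y - P f x)\<^sup>2) x" by (rule P_nonneg) simp
    also have "(\<lambda>y. (f y - P f x)\<^sup>2) = (\<lambda>y. ((f y)\<^sup>2 - (2 * P f x) * f y) + (P f x)\<^sup>2)"
      by (auto simp: power2_diff algebra_simps)
    also have "P \<dots> x = P (\<lambda>y. (f y)\<^sup>2) x - 2 * P f x * P f x + (P f x)\<^sup>2"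
      by (simp only: P_add P_diff P_scale P_const[OF that])
    finally show ?thesis by (simp add: power2_eq_square)
  qed
  have "ip (P f) (P f) \<le> mean (P (\<lambda>y. (f y)\<^sup>2))"
    unfolding ip_def mean_def power2_eq_square mult.assoc
    using jensen by (intro sum_mono mult_left_mono sd_nonneg) (simp add: power2_eq_square)
  also have "\<dots> = ip f f"
    unfolding mean_P by (simp add: mean_def ip_def power2_eq_square mult.assoc)
  finally show ?thesis .
qed

text \<open>The difference of the two sides is a quarter of \<open>ip f f - ip (P f) (P f)\<close>.
  Here laziness enters: a bound on the form of \<open>L\<close> becomes a bound on the norm of
  \<open>L f\<close>.\<close>

lemma L_square_le: "ip (L f) (L f) \<le> ip f (L f)"
proof -
  have "ip (L f) (L f) = (ip f f + 2 * ip f (P f) + ip (P f) (P f)) / 4"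
    unfolding L_alt ip_scale ip_scale2 ip_add ip_add2 ip_commute[of "P f" f] by simp
  moreover have "ip f (L f) = (ip f f + ip f (P f)) / 2"
    unfolding L_alt ip_scale2 ip_add2 by simp
  ultimately show ?thesis using P_contraction[of f] by simp
qed

section \<open>From eigenvalues to a variational bound\<close>

lemma eigen_iff:
  "lazy_eigen_perp V E \<mu> \<longleftrightarrow>
    (\<exists>f. (\<exists>x\<in>V. f x \<noteq> 0) \<and> mean f = 0 \<and> (\<forall>x\<in>V. L f x = \<mu> * f x))"
  unfolding lazy_eigen_perp_def mean_def by (simp add: lazy_srw_sum cong: ball_cong)

text \<open>\<open>g\<close> is the projection of \<open>f\<close> onto the span of the
  \<open>u i\<close>; the defect of the inequality is the squared norm of
  \<open>f - g\<close>.\<close>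

lemma bessel:
  assumes "finite F" and norm: "\<And>i. i \<in> F \<Longrightarrow> ip (u i) (u i) = 1"
    and orth: "\<And>i j. i \<in> F \<Longrightarrow> j \<in> F \<Longrightarrow> i \<noteq> j \<Longrightarrow> ip (u i) (u j) = 0"
  shows "(\<Sum>i\<in>F. (ip (u i) f)\<^sup>2) \<le> ip f f"
proof -
  define g where "g = (\<lambda>x. \<Sum>i\<in>F. ip (u i) f * u i x)"
  have ipg: "ip h g = (\<Sum>i\<in>F. ip (u i) f * ip h (u i))" for h
  proof -
    have "ip h g = (\<Sum>x\<in>V. \<Sum>i\<in>F. ip (u i) f * (sd x * h x * u i x))"
      by (simp add: ip_def g_def sum_distrib_left mult_ac)
    also have "\<dots> = (\<Sum>i\<in>F. \<Sum>x\<in>V. ip (u i) f * (sd x * h x * u i x))"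
      by (rule sum.swap)
    finally show ?thesis by (simp add: ip_def[of h] sum_distrib_left)
  qed
  have ui: "ip (u i) g = ip (u i) f" if "i \<in> F" for i
  proof -
    have "ip (u i) g = (\<Sum>j\<in>F. if j = i then ip (u j) f else 0)"
      unfolding ipg by (intro sum.cong) (use norm orth that in auto)
    then show ?thesis using that assms(1) by simp
  qed
  have fg: "ip f g = (\<Sum>i\<in>F. (ip (u i) f)\<^sup>2)"
    unfolding ipg by (simp add: power2_eq_square ip_commute[of f])
  have gg: "ip g g = (\<Sum>i\<in>F. (ip (u i) f)\<^sup>2)"
    unfolding ipg[of g] by (intro sum.cong) (simp_all add: power2_eq_square ip_commute[of g] ui)
  have "0 \<le> ip (\<lambda>x. f x - g x) (\<lambda>x. f x - g x)" by (rule ip_nonneg)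
  also have "\<dots> = ip f f - 2 * ip f g + ip g g"
    by (simp add: ip_diff ip_diff2 ip_commute[of g f])
  finally show ?thesis by (simp add: fg gg)
qed

text \<open>Bessel's inequality for the point mass at each \<open>x\<close>, summed over
  \<open>x\<close>: a trace computation that stands in for a dimension argument.\<close>

lemma orthonormal_card_le:
  assumes "finite F" and norm: "\<And>i. i \<in> F \<Longrightarrow> ip (u i) (u i) = 1"
    and orth: "\<And>i j. i \<in> F \<Longrightarrow> j \<in> F \<Longrightarrow> i \<noteq> j \<Longrightarrow> ip (u i) (u j) = 0"
  shows "card F \<le> card V"
proof -
  have pt: "(\<Sum>i\<in>F. sd x * u i x * u i x) \<le> 1" if x: "x \<in> V" for x
  proof -
    define \<delta> where "\<delta> = (\<lambda>y. if y = x then 1 else 0 :: real)"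
    have ip\<delta>: "ip h \<delta> = sd x * h x" for h
    proof -
      have "ip h \<delta> = (\<Sum>y\<in>V. if y = x then sd y * h y else 0)"
        unfolding ip_def \<delta>_def by (intro sum.cong) auto
      then show ?thesis using x by simp
    qed
    have "sd x * (\<Sum>i\<in>F. sd x * u i x * u i x) = (\<Sum>i\<in>F. (ip (u i) \<delta>)\<^sup>2)"
      unfolding ip\<delta> by (simp add: power2_eq_square sum_distrib_left mult_ac)
    also have "\<dots> \<le> ip \<delta> \<delta>"
      by (rule bessel[OF assms])
    also have "\<dots> = sd x * 1" unfolding ip\<delta> by (simp add: \<delta>_def)
    finally have "sd x * (\<Sum>i\<in>F. sd x * u i x * u i x) \<le> sd x * 1" .
    then show ?thesis using sd_pos[OF x] by (simp only: mult_le_cancel_left_pos)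
  qed
  have "real (card F) = (\<Sum>i\<in>F. ip (u i) (u i))" using norm by simp
  also have "\<dots> = (\<Sum>x\<in>V. \<Sum>i\<in>F. sd x * u i x * u i x)"
    unfolding ip_def by (rule sum.swap)
  also have "\<dots> \<le> (\<Sum>x\<in>V. 1)" by (intro sum_mono pt)
  finally show ?thesis by simp
qed

text \<open>Needed for the \<open>Max\<close> in \<open>spectral_gap\<close> to be an upper bound.
  Eigenvectors of the self-adjoint \<open>L\<close> for distinct eigenvalues are orthogonal, so
  every finite set of eigenvalues has at most \<open>card V\<close> elements.\<close>

lemma finite_eigen: "finite {\<mu>. lazy_eigen_perp V E \<mu>}"
proof (rule conjunct1[OF finite_if_finite_subsets_card_bdd])
  fix F assume F: "F \<subseteq> {\<mu>. lazy_eigen_perp V E \<mu>}" "finite F"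
  have "\<forall>\<mu>\<in>F. \<exists>f. ip f f = 1 \<and> (\<forall>x\<in>V. L f x = \<mu> * f x)"
  proof
    fix \<mu> assume "\<mu> \<in> F"
    then obtain f x where f: "x \<in> V" "f x \<noteq> 0" "\<forall>x\<in>V. L f x = \<mu> * f x"
      using F by (auto simp: eigen_iff)
    define r where "r = ip f f"
    have r: "r > 0" using ip_nonneg[of f] ip_eq_0[of f x] f by (auto simp: r_def less_le)
    define g where "g = (\<lambda>x. (1 / sqrt r) * f x)"
    have "ip g g = (1 / sqrt r) * ((1 / sqrt r) * r)"
      unfolding g_def ip_scale ip_scale2 r_def by simp
    also have "\<dots> = 1" using r by (simp add: field_simps)
    finally have "ip g g = 1" .
    moreover have "L g x = (1 / sqrt r) * L f x" for x
      unfolding g_def L_def P_scale by (simp add: add_divide_distrib)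
    then have "\<forall>x\<in>V. L g x = \<mu> * g x"
      using f(3) by (simp add: g_def)
    ultimately show "\<exists>f. ip f f = 1 \<and> (\<forall>x\<in>V. L f x = \<mu> * f x)" by blast
  qed
  then obtain u where u: "\<And>\<mu>. \<mu> \<in> F \<Longrightarrow> ip (u \<mu>) (u \<mu>) = 1"
    "\<And>\<mu> x. \<mu> \<in> F \<Longrightarrow> x \<in> V \<Longrightarrow> L (u \<mu>) x = \<mu> * u \<mu> x"
    by metis
  show "card F \<le> card V"
  proof (rule orthonormal_card_le[OF F(2), of u])
    fix i j assume ij: "i \<in> F" "j \<in> F" "i \<noteq> j"
    have "i * ip (u i) (u j) = ip (L (u i)) (u j)"
      unfolding ip_scale[symmetric] by (rule ip_cong) (auto simp: u ij)
    also have "\<dots> = j * ip (u i) (u j)"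
      unfolding ip_scale2[symmetric] L_adjoint by (rule ip_cong) (auto simp: u ij)
    finally show "ip (u i) (u j) = 0" using ij(3) by auto
  qed (use u in auto)
qed

text \<open>The type \<open>'a\<close> may be infinite, so functions are forced to vanish off
  \<open>V\<close>. The set is then closed in a product of compact intervals, which is compact by
  Tychonoff.\<close>

lemma compact_unit_sphere:
  "compact {f. (\<forall>x. x \<notin> V \<longrightarrow> f x = 0) \<and> mean f = 0 \<and> ip f f = 1}" (is "compact ?K")
proof -
  define R where "R x = (if x \<in> V then 1 / sqrt (sd x) else 0)" for x
  have c: "compact (PiE UNIV (\<lambda>x. {- R x .. R x}))"
  proof -
    have "compactin (product_topology (\<lambda>x::'a. euclidean :: real topology) UNIV)
        (PiE UNIV (\<lambda>x. {- R x .. R x}))"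
      by (subst compactin_PiE) auto
    then show ?thesis by (simp add: euclidean_product_topology)
  qed
  have cont: "continuous_on UNIV (\<lambda>f :: 'a \<Rightarrow> real. f x)" for x
    by (rule continuous_on_product_coordinates)
  have cm: "continuous_on UNIV mean"
    unfolding mean_def by (intro continuous_intros cont)
  have ci: "continuous_on UNIV (\<lambda>f. ip f f)"
    unfolding ip_def by (intro continuous_intros cont)
  have "closed ?K"
  proof -
    have "?K = (\<Inter>x\<in>-V. {f. f x = 0}) \<inter> {f. mean f = 0} \<inter> {f. ip f f = 1}" by auto
    also have "closed \<dots>"
      by (intro closed_Int closed_INT ballI closed_Collect_eq cont cm ci continuous_on_const)
    finally show ?thesis .
  qed
  moreover have "?K \<subseteq> PiE UNIV (\<lambda>x. {- R x .. R x})"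
  proof
    fix f assume f: "f \<in> ?K"
    have "\<bar>f x\<bar> \<le> R x" for x
    proof (cases "x \<in> V")
      case True
      have "sd x * (f x)\<^sup>2 \<le> 1" using point_le_ip[OF True, of f] f by simp
      then have "sqrt (sd x * (f x)\<^sup>2) \<le> sqrt 1" using real_sqrt_le_mono by blast
      then show ?thesis using sd_pos[OF True] True
        by (simp add: R_def real_sqrt_mult field_simps)
    qed (use f in \<open>auto simp: R_def\<close>)
    then show "f \<in> PiE UNIV (\<lambda>x. {- R x .. R x})"
      by (auto simp: PiE_def abs_le_iff minus_le_iff)
  qed
  ultimately show ?thesis
    using compact_Int_closed[OF c, of ?K] by (simp only: Int_absorb1)
qed

text \<open>A maximiser of the Rayleigh quotient on the mean-zero unit sphere is an eigenvector.\<close>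

lemma rayleigh_le_lambda:
  assumes "mean g = 0"
  shows "ip g (L g) \<le> (1 - spectral_gap V E) * ip g g"
proof (cases "ip g g = 0")
  case True
  then have "\<forall>x\<in>V. g x = 0" using ip_eq_0[of g] by simp
  then have "ip g (L g) = ip (\<lambda>x. 0) (L g)" by (intro ip_cong) auto
  then show ?thesis using True by (simp add: ip_def)
next
  case False
  define K where "K = {f. (\<forall>x. x \<notin> V \<longrightarrow> f x = 0) \<and> mean f = 0 \<and> ip f f = 1}"
  \<comment> \<open>Rescaling and cutting off outside \<open>V\<close> moves \<open>h\<close> into
    \<open>K\<close>; neither \<open>ip\<close> nor \<open>mean\<close> sees values off
    \<open>V\<close>.\<close>
  have normalise: "\<exists>f\<in>K. ip h (L h) = ip h h * ip f (L f)" if h: "mean h = 0" "ip h h \<noteq> 0" for h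
  proof -
    define r where "r = ip h h"
    have r: "r > 0" using ip_nonneg[of h] h(2) by (simp add: r_def)
    define f where "f = (\<lambda>x. (1 / sqrt r) * (if x \<in> V then h x else 0))"
    have c: "ip f g' = (1 / sqrt r) * ip h g'" for g'
      unfolding f_def ip_scale by (intro arg_cong2[where f="(*)"] refl ip_cong) auto
    have "mean f = (1 / sqrt r) * mean h"
      unfolding f_def mean_scale by (simp add: mean_def)
    moreover have "ip f f = 1"
      unfolding c ip_commute[of h f] using r by (simp add: r_def[symmetric] field_simps)
    ultimately have "f \<in> K" using h by (auto simp: K_def f_def)
    moreover have "ip f (L f) = 1 / sqrt r * (1 / sqrt r) * ip h (L h)"
    proof -
      have "ip h (L f) = ip f (L h)"
        using L_adjoint[of h f] ip_commute[of "L h" f] by simp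
      then show ?thesis using c[of "L f"] c[of "L h"] by simp
    qed
    then have "ip h (L h) = r * ip f (L f)" using r by (simp add: field_simps)
    ultimately show ?thesis by (auto simp: r_def)
  qed
  have "K \<noteq> {}" using normalise[OF assms False] by auto
  moreover have "compact K" unfolding K_def by (rule compact_unit_sphere)
  moreover have "continuous_on K (\<lambda>f. ip f (L f))"
    unfolding ip_def L_def P_def
    by (intro continuous_intros continuous_on_subset[OF continuous_on_product_coordinates subset_UNIV]) auto
  ultimately obtain f where f: "f \<in> K" "\<And>h. h \<in> K \<Longrightarrow> ip h (L h) \<le> ip f (L f)"
    using continuous_attains_sup[of K "\<lambda>f. ip f (L f)"] by auto
  define \<mu> where "\<mu> = ip f (L f)"
  have max: "ip h (L h) \<le> \<mu> * ip h h" if h: "mean h = 0" for h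
  proof (cases "ip h h = 0")
    case True
    then have "\<forall>x\<in>V. h x = 0" using ip_eq_0[of h] by simp
    then have "ip h (L h) = ip (\<lambda>x. 0) (L h)" by (intro ip_cong) auto
    then show ?thesis using True by (simp add: ip_def)
  next
    case False
    obtain f' where f': "f' \<in> K" "ip h (L h) = ip h h * ip f' (L f')"
      using normalise[OF h False] by auto
    show ?thesis using f(2)[OF f'(1)] ip_nonneg[of h]
      by (simp add: f'(2) \<mu>_def mult.commute mult_left_mono)
  qed
  have mf: "mean f = 0" "ip f f = 1" using f(1) by (auto simp: K_def)
  have L_lin: "L (\<lambda>x. a x + t * b x) = (\<lambda>x. L a x + t * L b x)" for a b t
    by (rule ext) (simp add: L_def P_add P_scale field_simps)
  \<comment> \<open>First variation at the maximiser: the form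
    \<open>\<mu> * ip k k - ip k (L k)\<close> is nonnegative along \<open>f + t h\<close> and
    vanishes at t = 0, so its linear coefficient is zero.\<close>
  have crit: "\<mu> * ip f h - ip (L f) h = 0" if h: "mean h = 0" for h
  proof (rule nonneg_quadratic_linear_coeff)
    fix t :: real
    define k where "k = (\<lambda>x. f x + t * h x)"
    have "mean k = 0" unfolding k_def mean_add mean_scale using mf h by simp
    then have "0 \<le> \<mu> * ip k k - ip k (L k)" using max[of k] by simp
    also have "ip k k = ip f f + 2 * t * ip f h + t\<^sup>2 * ip h h"
      unfolding k_def ip_add ip_add2 ip_scale ip_scale2 ip_commute[of h f]
      by (simp add: algebra_simps power2_eq_square)
    also have "ip k (L k) = ip f (L f) + 2 * t * ip (L f) h + t\<^sup>2 * ip h (L h)"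
      unfolding k_def L_lin ip_add ip_add2 ip_scale ip_scale2
      by (simp add: algebra_simps power2_eq_square L_adjoint ip_commute[of h "L f"])
    finally show "0 \<le> 2 * t * (\<mu> * ip f h - ip (L f) h) + t\<^sup>2 * (\<mu> * ip h h - ip h (L h))"
      by (simp add: mf \<mu>_def[symmetric] algebra_simps)
  qed
  \<comment> \<open>The residual is itself an admissible direction because \<open>L\<close>
    preserves the mean; testing against it gives \<open>ip r r = 0\<close>.\<close>
  define r where "r = (\<lambda>x. L f x - \<mu> * f x)"
  have "mean r = 0" unfolding r_def mean_diff mean_scale mean_L mf by simp
  from crit[OF this] have "ip r r = 0"
    by (simp add: r_def ip_diff ip_scale)
  then have "\<forall>x\<in>V. L f x = \<mu> * f x" using ip_eq_0[of r] by (simp add: r_def)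
  moreover have "\<exists>x\<in>V. f x \<noteq> 0"
  proof (rule ccontr)
    assume "\<not> ?thesis"
    then have "ip f f = ip (\<lambda>x. 0) f" by (intro ip_cong) auto
    then show False using mf by (simp add: ip_def)
  qed
  ultimately have "lazy_eigen_perp V E \<mu>" unfolding eigen_iff using mf by auto
  then have "\<mu> \<le> 1 - spectral_gap V E"
    unfolding spectral_gap_def using finite_eigen by simp
  then have "\<mu> * ip g g \<le> (1 - spectral_gap V E) * ip g g"
    using ip_nonneg by (rule mult_right_mono)
  then show ?thesis using max[OF assms] by linarith
qed

end

section \<open>Poincare inequality, mixing, and bounds for subsolutions\<close>

locale gap_graph = finite_connected_graph +
  fixes \<gamma> :: real
  assumes \<gamma>_pos: "\<gamma> > 0" and \<gamma>_le_1: "\<gamma> \<le> 1" and gap: "spectral_gap V E \<ge> \<gamma>"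
begin

lemma lazy_contraction: "mean g = 0 \<Longrightarrow> ip g (L g) \<le> (1 - \<gamma>) * ip g g"
  using rayleigh_le_lambda[of g] mult_right_mono[OF _ ip_nonneg[of g], of "1 - spectral_gap V E" "1 - \<gamma>"] gap
  by linarith

lemma variance_eq: "ip (\<lambda>x. g x - mean g) (\<lambda>x. g x - mean g) = ip g g - (mean g)\<^sup>2"
  unfolding ip_diff ip_diff2 ip_const ip_commute[of "\<lambda>x. mean g" g] mean_const
  by (simp add: power2_eq_square)

text \<open>The gap of \<open>L\<close> applied to the centred function; the factor 2 arises because
  I - L = (I - P)/2.\<close>

lemma poincare: "2 * \<gamma> * (ip g g - (mean g)\<^sup>2) \<le> ip g g - ip g (P g)"
proof -
  define f where "f = (\<lambda>x. g x - mean g)"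
  have mf: "mean f = 0" unfolding f_def mean_diff mean_const by simp
  have ff: "ip f f = ip g g - (mean g)\<^sup>2"
    unfolding f_def by (rule variance_eq)
  have "ip f (P f) = ip f (\<lambda>x. P g x - mean g)"
    unfolding f_def by (rule ip_cong) (auto simp: P_diff P_const)
  also have "\<dots> = ip f (P g)" unfolding ip_diff2 ip_const mf by simp
  also have "\<dots> = ip g (P g) - (mean g)\<^sup>2"
    unfolding f_def ip_diff ip_commute[of "\<lambda>x. mean g" "P g"] ip_const mean_P
    by (simp add: power2_eq_square)
  finally have fP: "ip f (P f) = ip g (P g) - (mean g)\<^sup>2" .
  have "ip f (L f) = (ip f f + ip f (P f)) / 2"
    unfolding L_alt ip_scale2 ip_add2 by simp
  then show ?thesis using lazy_contraction[OF mf] by (simp add: ff fP algebra_simps)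
qed

lemma L_iterate_contraction:
  assumes "mean f = 0"
  shows "mean ((L ^^ k) f) = 0 \<and> ip ((L ^^ k) f) ((L ^^ k) f) \<le> (1 - \<gamma>) ^ k * ip f f"
proof (induction k)
  case (Suc k)
  let ?g = "(L ^^ k) f"
  have "ip (L ?g) (L ?g) \<le> (1 - \<gamma>) * ip ?g ?g"
    using L_square_le[of ?g] lazy_contraction[of ?g] Suc by linarith
  also have "\<dots> \<le> (1 - \<gamma>) * ((1 - \<gamma>) ^ k * ip f f)"
    using Suc \<gamma>_le_1 by (intro mult_left_mono) auto
  finally show ?case using Suc by (simp add: mean_L mult.assoc)
qed (simp add: assms)

text \<open>Functions like the mean hitting time of \<open>S\<close>: the energy of \<open>g\<close> is at most its mean, and its
  variance is at least \<open>\<pi>(S)\<close> times the squared mean.\<close>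

lemma subsolution_mean:
  assumes S: "S \<subseteq> V" "S \<noteq> {}"
    and nonneg: "\<And>y. y \<in> V \<Longrightarrow> 0 \<le> g y" and zero: "\<And>y. y \<in> S \<Longrightarrow> g y = 0"
    and sub: "\<And>y. y \<in> V - S \<Longrightarrow> g y - P g y \<le> 1"
  shows "2 * \<gamma> * (ip g g - (mean g)\<^sup>2) \<le> mean g"
    and "mean g \<le> 1 / (2 * \<gamma> * (\<Sum>x\<in>S. sd x))"
proof -
  have fS: "finite S" using S fin finite_subset by blast
  have "ip g g - ip g (P g) = (\<Sum>x\<in>V. sd x * (g x * (g x - P g x)))"
    by (simp add: ip_def algebra_simps sum_subtractf)
  \<comment> \<open>Testing against \<open>g\<close> itself removes the points of \<open>S\<close>,
    where the value of \<open>g - P g\<close> is not controlled from below.\<close>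
  also have "\<dots> \<le> mean g"
    unfolding mean_def
  proof (intro sum_mono mult_left_mono sd_nonneg)
    fix x assume x: "x \<in> V"
    show "g x * (g x - P g x) \<le> g x"
      using zero[of x] nonneg[OF x] sub[of x] x mult_left_mono[of "g x - P g x" 1 "g x"]
      by (cases "x \<in> S") auto
  qed
  finally show 1: "2 * \<gamma> * (ip g g - (mean g)\<^sup>2) \<le> mean g"
    using poincare[of g] by linarith
  define s where "s = (\<Sum>x\<in>S. sd x)"
  have s: "s > 0" unfolding s_def using S fS sd_pos by (intro sum_pos) auto
  have m: "mean g \<ge> 0" unfolding mean_def
    by (intro sum_nonneg mult_nonneg_nonneg sd_nonneg nonneg)
  have "s * (mean g)\<^sup>2 = (\<Sum>x\<in>S. sd x * (g x - mean g) * (g x - mean g))"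
    unfolding s_def sum_distrib_right
    by (intro sum.cong) (auto simp: zero power2_eq_square)
  also have "\<dots> \<le> ip (\<lambda>x. g x - mean g) (\<lambda>x. g x - mean g)"
    unfolding ip_def using S by (intro sum_mono2) (auto simp: mult.assoc sd_nonneg)
  also have "\<dots> = ip g g - (mean g)\<^sup>2" by (rule variance_eq)
  finally have "2 * \<gamma> * (s * (mean g)\<^sup>2) \<le> 2 * \<gamma> * (ip g g - (mean g)\<^sup>2)"
    using \<gamma>_pos by (intro mult_left_mono) auto
  with 1 have 2: "(2 * \<gamma> * s * mean g) * mean g \<le> 1 * mean g"
    by (simp add: power2_eq_square mult.assoc)
  have "2 * \<gamma> * s * mean g \<le> 1"
  proof (cases "mean g = 0")
    case False
    then show ?thesis using m 2 mult_right_le_imp_le[of "2 * \<gamma> * s * mean g" "mean g" 1] by simp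
  qed simp
  then show "mean g \<le> 1 / (2 * \<gamma> * (\<Sum>x\<in>S. sd x))"
    using s \<gamma>_pos by (simp add: s_def[symmetric] field_simps)
qed

text \<open>One lazy step costs at most 1/2, so the centred function at \<open>z\<close> is at most
  k/2 plus its \<open>k\<close>-th lazy iterate. The choice of \<open>k\<close> cancels the factor 1
  / \<open>sd z\<close> paid for evaluating at a point, and leaves the standard deviation of
  \<open>g\<close>.\<close>

lemma subsolution_sup:
  assumes S: "S \<subseteq> V" "S \<noteq> {}"
    and nonneg: "\<And>y. y \<in> V \<Longrightarrow> 0 \<le> g y" and zero: "\<And>y. y \<in> S \<Longrightarrow> g y = 0"
    and sub: "\<And>y. y \<in> V - S \<Longrightarrow> g y - P g y \<le> 1"
    and z: "z \<in> V" and k: "(1 - \<gamma>) ^ k \<le> sd z"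
  shows "g z \<le> real k / 2 + 1 / (\<gamma> * (\<Sum>x\<in>S. sd x)) + 1 / \<gamma>"
proof -
  define s where "s = (\<Sum>x\<in>S. sd x)"
  have s: "s > 0" unfolding s_def
    using S finite_subset[OF S(1) fin] sd_pos by (intro sum_pos) auto
  define f where "f = (\<lambda>x. g x - mean g)"
  have mf: "mean f = 0" unfolding f_def mean_diff mean_const by simp
  \<comment> \<open>The inequality \<open>g - P g \<le> 1\<close> extends to \<open>S\<close>, where
    \<open>g\<close> is 0 and \<open>P g\<close> is nonnegative.\<close>
  have step: "f y \<le> 1/2 + L f y" if y: "y \<in> V" for y
  proof -
    have "g y - P g y \<le> 1"
      using zero[of y] sub[of y] y P_nonneg[of g y] nonneg by (cases "y \<in> S") auto
    then show ?thesis unfolding f_def L_def P_diff P_const[OF y] by (simp add: field_simps)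
  qed
  have iter: "f y \<le> real j / 2 + (L ^^ j) f y" if "y \<in> V" for j y
    using that
  proof (induction j arbitrary: y)
    case (Suc j)
    have "f y \<le> 1/2 + L f y" using step Suc by simp
    also have "L f y \<le> L (\<lambda>x. real j / 2 + (L ^^ j) f x) y"
      using Suc by (intro L_mono) auto
    also have "\<dots> = real j / 2 + L ((L ^^ j) f) y"
      unfolding L_def P_add P_const[OF Suc.prems] by (simp add: field_simps)
    finally show ?case by (simp add: field_simps)
  qed simp
  have m: "mean g \<ge> 0" unfolding mean_def
    by (intro sum_nonneg mult_nonneg_nonneg sd_nonneg nonneg)
  have "sd z * ((L ^^ k) f z)\<^sup>2 \<le> ip ((L ^^ k) f) ((L ^^ k) f)"
    by (rule point_le_ip[OF z])
  also have "\<dots> \<le> (1 - \<gamma>) ^ k * ip f f"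
    using L_iterate_contraction[OF mf] by blast
  also have "\<dots> \<le> sd z * ip f f"
    by (intro mult_right_mono k ip_nonneg)
  finally have "((L ^^ k) f z)\<^sup>2 \<le> ip f f"
    using sd_pos[OF z] by simp
  also have "\<dots> \<le> mean g / (2 * \<gamma>)"
    using subsolution_mean(1)[OF S nonneg zero sub] \<gamma>_pos
    unfolding f_def variance_eq by (simp add: field_simps)
  \<comment> \<open>Dominating by a perfect square (its cross term suffices) gives a bound linear in
    \<open>mean g\<close> when the root is taken.\<close>
  also have "\<dots> \<le> (mean g + 1 / \<gamma>)\<^sup>2"
  proof -
    have "mean g / (2 * \<gamma>) \<le> 2 * (mean g * (1 / \<gamma>))"
      using m \<gamma>_pos by (simp add: field_simps)
    also have "\<dots> \<le> (mean g + 1 / \<gamma>)\<^sup>2"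
      unfolding power2_sum by simp
    finally show ?thesis .
  qed
  finally have "(L ^^ k) f z \<le> mean g + 1 / \<gamma>"
    by (rule power2_le_imp_le) (use m \<gamma>_pos in auto)
  with iter[OF z, of k] have "g z \<le> real k / 2 + 2 * mean g + 1 / \<gamma>"
    by (simp add: f_def)
  also have "2 * mean g \<le> 1 / (\<gamma> * s)"
    using subsolution_mean(2)[OF S nonneg zero sub] by (simp add: s_def field_simps)
  finally show ?thesis by (simp add: s_def)
qed

section \<open>Hitting probabilities, hitting times and harmonic measure\<close>

lemma hit_le_nonneg: "hit_le V E S x t y \<ge> 0"
  by (induction t arbitrary: y) (auto intro!: sum_nonneg mult_nonneg_nonneg srw_nonneg)

lemma hit_le_Suc: "y \<notin> S \<Longrightarrow> hit_le V E S x (Suc t) y = P (hit_le V E S x t) y"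
  by (simp add: P_def)

lemma hit_le_on: "y \<in> S \<Longrightarrow> hit_le V E S x t y = (if y = x then 1 else 0)"
  by (cases t) auto

lemma hit_le_mono: "hit_le V E S x t y \<le> hit_le V E S x (Suc t) y"
proof (induction t arbitrary: y)
  case 0
  then show ?case
    by (cases "y \<in> S") (auto simp: hit_le_on hit_le_Suc intro!: P_nonneg simp del: hit_le.simps(2))
next
  case (Suc t)
  show ?case
  proof (cases "y \<in> S")
    case False
    then show ?thesis using Suc by (simp only: hit_le_Suc P_mono not_False_eq_True)
  qed (simp add: hit_le_on)
qed

text \<open>The tail Pr_y[T_S > t].\<close>

definition surv :: "'a set \<Rightarrow> nat \<Rightarrow> 'a \<Rightarrow> real" where
  "surv S t y = 1 - (\<Sum>x\<in>S. hit_le V E S x t y)"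

lemma surv_on: "S \<subseteq> V \<Longrightarrow> y \<in> S \<Longrightarrow> surv S t y = 0"
  using finite_subset[OF _ fin, of S] by (simp add: surv_def hit_le_on)

lemma surv_0: "S \<subseteq> V \<Longrightarrow> y \<notin> S \<Longrightarrow> surv S 0 y = 1"
  by (simp add: surv_def)

lemma surv_Suc:
  assumes "y \<in> V" "y \<notin> S"
  shows "surv S (Suc t) y = P (surv S t) y"
proof -
  have "P (surv S t) y = 1 - P (\<lambda>z. \<Sum>x\<in>S. hit_le V E S x t z) y"
    unfolding surv_def P_diff P_const[OF assms(1)] ..
  also have "P (\<lambda>z. \<Sum>x\<in>S. hit_le V E S x t z) y = (\<Sum>x\<in>S. P (hit_le V E S x t) y)"
    unfolding P_def sum_distrib_left by (rule sum.swap)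
  finally have "P (surv S t) y = 1 - (\<Sum>x\<in>S. P (hit_le V E S x t) y)" .
  moreover have "surv S (Suc t) y = 1 - (\<Sum>x\<in>S. P (hit_le V E S x t) y)"
    unfolding surv_def hit_le_Suc[OF assms(2)] ..
  ultimately show ?thesis by simp
qed

lemma surv_nonneg:
  assumes "S \<subseteq> V" "y \<in> V"
  shows "surv S t y \<ge> 0"
  using assms(2)
proof (induction t arbitrary: y)
  case 0
  then show ?case using surv_0[OF assms(1), of y] surv_on[OF assms(1), of y 0] by (cases "y \<in> S") auto
next
  case (Suc t)
  then show ?case
    using surv_on[OF assms(1), of y "Suc t"] surv_Suc[of y S t] P_nonneg[of "surv S t" y]
    by (cases "y \<in> S") auto
qed

lemma hit_le_le_1:
  assumes "S \<subseteq> V" "x \<in> S" "y \<in> V"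
  shows "hit_le V E S x t y \<le> 1"
proof -
  have "hit_le V E S x t y \<le> (\<Sum>x\<in>S. hit_le V E S x t y)"
    using assms finite_subset[OF assms(1) fin] by (intro member_le_sum) (auto simp: hit_le_nonneg)
  then show ?thesis using surv_nonneg[OF assms(1,3), of t] by (simp add: surv_def)
qed

text \<open>The expectation of T_S from \<open>y\<close>, written as the sum of its tails.\<close>

definition hit_time :: "'a set \<Rightarrow> 'a \<Rightarrow> real" where
  "hit_time S y = (\<Sum>k. surv S k y)"

text \<open>First-step analysis for the truncated expectation E_y[min(T_S, t)], which is finite
  before summability is known.\<close>

lemma sum_surv_Suc:
  assumes "S \<subseteq> V" "y \<in> V" "y \<notin> S"
  shows "(\<Sum>k<Suc t. surv S k y) = 1 + P (\<lambda>z. \<Sum>k<t. surv S k z) y"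
proof -
  have "P (\<lambda>z. \<Sum>k<t. surv S k z) y = (\<Sum>k<t. P (surv S k) y)"
    unfolding P_def sum_distrib_left by (rule sum.swap)
  also have "\<dots> = (\<Sum>k<t. surv S (Suc k) y)"
    using surv_Suc[OF assms(2,3)] by simp
  finally show ?thesis
    using surv_0[OF assms(1,3)] by (simp only: sum.lessThan_Suc_shift)
qed

lemma exists_mixing_time:
  assumes "z \<in> V" shows "\<exists>k. (1 - \<gamma>) ^ k \<le> sd z"
  using real_arch_pow_inv[of "sd z" "1 - \<gamma>"] sd_pos[OF assms] \<gamma>_pos by (auto intro: less_imp_le)

text \<open>The truncated hitting times are subsolutions, so \<open>subsolution_sup\<close> bounds
  all partial sums by one constant. They satisfy the first-step equation only as an inequality,
  hence the formulation with subsolutions.\<close>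

lemma summable_surv:
  assumes S: "S \<subseteq> V" "S \<noteq> {}" and z: "z \<in> V"
  shows "summable (\<lambda>k. surv S k z)"
proof -
  obtain k where k: "(1 - \<gamma>) ^ k \<le> sd z" using exists_mixing_time[OF z] by blast
  show ?thesis
  proof (rule bounded_imp_summable)
    show "0 \<le> surv S t z" for t by (rule surv_nonneg[OF S(1) z])
    show "(\<Sum>j\<le>t. surv S j z) \<le> real k / 2 + 1 / (\<gamma> * (\<Sum>x\<in>S. sd x)) + 1 / \<gamma>" for t
      unfolding lessThan_Suc_atMost[symmetric]
    proof (rule subsolution_sup[OF S _ _ _ z k])
      fix y assume y: "y \<in> V - S"
      have "(\<Sum>j<Suc t. surv S j y) \<le> (\<Sum>j<Suc (Suc t). surv S j y)"
        using surv_nonneg[OF S(1), of y "Suc t"] y by simp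
      then show "(\<Sum>j<Suc t. surv S j y) - P (\<lambda>z. \<Sum>j<Suc t. surv S j z) y \<le> 1"
        using sum_surv_Suc[OF S(1), of y "Suc t"] y by simp
    qed (use S(1) in \<open>auto intro!: sum_nonneg surv_nonneg simp: surv_on simp del: sum.lessThan_Suc\<close>)
  qed
qed

lemma hit_time_nonneg: "S \<subseteq> V \<Longrightarrow> S \<noteq> {} \<Longrightarrow> y \<in> V \<Longrightarrow> hit_time S y \<ge> 0"
  unfolding hit_time_def by (rule suminf_nonneg) (auto intro: summable_surv surv_nonneg)

lemma hit_time_on: "S \<subseteq> V \<Longrightarrow> y \<in> S \<Longrightarrow> hit_time S y = 0"
  by (simp add: hit_time_def surv_on)

lemma hit_time_off:
  assumes S: "S \<subseteq> V" "S \<noteq> {}" and y: "y \<in> V" "y \<notin> S"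
  shows "hit_time S y = 1 + P (hit_time S) y"
proof -
  have lim: "(\<lambda>t. \<Sum>k<t. surv S k z) \<longlonglongrightarrow> hit_time S z" if "z \<in> V" for z
    unfolding hit_time_def by (rule summable_LIMSEQ[OF summable_surv[OF S that]])
  have "(\<lambda>t. 1 + P (\<lambda>z. \<Sum>k<t. surv S k z) y) \<longlonglongrightarrow> 1 + P (hit_time S) y"
    unfolding P_def by (intro tendsto_intros lim)
  moreover have "(\<lambda>t. 1 + P (\<lambda>z. \<Sum>k<t. surv S k z) y) \<longlonglongrightarrow> hit_time S y"
    unfolding sum_surv_Suc[OF S(1) y, symmetric] by (rule LIMSEQ_Suc[OF lim[OF y(1)]])
  ultimately show ?thesis using LIMSEQ_unique by blast
qed

lemma hit_time_le:
  assumes S: "S \<subseteq> V" "S \<noteq> {}" and z: "z \<in> V" and k: "(1 - \<gamma>) ^ k \<le> sd z"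
  shows "hit_time S z \<le> real k / 2 + 1 / (\<gamma> * (\<Sum>x\<in>S. sd x)) + 1 / \<gamma>"
  using hit_time_off[OF S] by (intro subsolution_sup[OF S _ _ _ z k] hit_time_nonneg S hit_time_on) auto

lemma hit_le_tendsto_hitprob:
  assumes "S \<subseteq> V" "x \<in> S" "y \<in> V"
  shows "(\<lambda>t. hit_le V E S x t y) \<longlonglongrightarrow> hitprob V E S x y"
proof -
  have "incseq (\<lambda>t. hit_le V E S x t y)"
    by (rule incseq_SucI) (rule hit_le_mono)
  then have "convergent (\<lambda>t. hit_le V E S x t y)"
    using hit_le_le_1[OF assms] by (meson incseq_convergent convergentI)
  then show ?thesis unfolding hitprob_def by (simp add: convergent_LIMSEQ_iff)
qed

lemma mean_hit_le_tendsto_harm: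
  assumes "S \<subseteq> V" "x \<in> S"
  shows "(\<lambda>t. mean (hit_le V E S x t)) \<longlonglongrightarrow> harm V E S x"
  unfolding harm_def mean_def by (intro tendsto_intros hit_le_tendsto_hitprob assms)

lemma harm_nonneg:
  assumes "S \<subseteq> V" "x \<in> S"
  shows "harm V E S x \<ge> 0"
  by (rule tendsto_lowerbound[OF mean_hit_le_tendsto_harm[OF assms]])
    (auto simp: mean_def intro!: always_eventually sum_nonneg mult_nonneg_nonneg sd_nonneg hit_le_nonneg)

text \<open>The tails are summable, so they tend to 0: the walk hits \<open>S\<close> almost surely
  and no mass is lost in the limit.\<close>

lemma sum_harm:
  assumes S: "S \<subseteq> V" "S \<noteq> {}"
  shows "(\<Sum>x\<in>S. harm V E S x) = 1"
proof -
  have "(\<Sum>x\<in>S. hitprob V E S x y) = 1" if y: "y \<in> V" for y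
  proof -
    have "(\<lambda>t. surv S t y) \<longlonglongrightarrow> 1 - (\<Sum>x\<in>S. hitprob V E S x y)"
      unfolding surv_def by (intro tendsto_intros hit_le_tendsto_hitprob S y)
    moreover have "(\<lambda>t. surv S t y) \<longlonglongrightarrow> 0"
      by (rule summable_LIMSEQ_zero[OF summable_surv[OF S y]])
    ultimately show ?thesis using LIMSEQ_unique by fastforce
  qed
  then have "(\<Sum>y\<in>V. sd y * (\<Sum>x\<in>S. hitprob V E S x y)) = 1"
    by (simp add: sum_sd)
  then show ?thesis unfolding harm_def
    by (subst sum.swap) (simp add: sum_distrib_left)
qed

text \<open>Duality: \<open>v = hit_le V E S x t\<close> is subharmonic off \<open>S\<close> and \<open>u\<close> solves \<open>u - P u = 1\<close> off
  \<open>A \<union> S\<close>, so \<open>\<langle>v, u - P u\<rangle> = \<langle>v - P v, u\<rangle> \<le> 0\<close>. Taking \<open>u\<close> to vanish on all of \<open>A\<close> makes the bound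
  depend on the size of \<open>A\<close>, without an isoperimetric inequality for its boundary \<open>S\<close>.\<close>

lemma harm_le_hit_time:
  assumes S: "S \<subseteq> V" and x: "x \<in> S" and A: "A \<subseteq> V" "A \<inter> S = {}"
    and closed: "\<And>y z. y \<in> A \<Longrightarrow> E y z \<Longrightarrow> z \<in> A \<union> S"
  shows "harm V E S x \<le> sd x * (1 + P (hit_time (A \<union> S)) x) + (\<Sum>y\<in>A. sd y)"
proof (rule tendsto_upperbound[OF mean_hit_le_tendsto_harm[OF S x]])
  define u where "u = hit_time (A \<union> S)"
  have S': "A \<union> S \<subseteq> V" "A \<union> S \<noteq> {}" using S x A by auto
  have u_on: "u y = 0" if "y \<in> A \<union> S" for y
    unfolding u_def using hit_time_on[OF S'(1) that] .
  have u_off: "u y - P u y = 1" if "y \<in> V" "y \<notin> A \<union> S" for y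
    unfolding u_def using hit_time_off[OF S' that] by simp
  have u_nonneg: "u y \<ge> 0" if "y \<in> V" for y
    unfolding u_def using hit_time_nonneg[OF S' that] .
  \<comment> \<open>All neighbours of \<open>A\<close> lie in \<open>A \<union> S\<close>, where
    \<open>u\<close> vanishes.\<close>
  have Pu: "P u y = 0" if "y \<in> A" for y
    unfolding P_def
  proof (intro sum.neutral ballI)
    fix z show "srw V E y z * u z = 0"
      using closed[OF that, of z] u_on[of z] by (cases "E y z") (auto simp: srw_def)
  qed
  have "mean (hit_le V E S x t) \<le> sd x * (1 + P u x) + (\<Sum>y\<in>A. sd y)" for t
  proof -
    define v where "v = hit_le V E S x t"
    have "ip v (\<lambda>y. u y - P u y) = ip (\<lambda>y. v y - P v y) u"
      unfolding ip_diff ip_diff2 P_adjoint ..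
    also have "\<dots> \<le> 0"
      unfolding ip_def
    proof (intro sum_nonpos)
      fix y assume y: "y \<in> V"
      show "sd y * (v y - P v y) * u y \<le> 0"
      proof (cases "y \<in> S")
        case False
        then have "v y - P v y \<le> 0"
          using hit_le_mono[of S x t y] unfolding v_def hit_le_Suc[OF False] by simp
        then show ?thesis using u_nonneg[OF y] sd_nonneg[of y]
          by (simp add: mult_nonneg_nonpos mult_nonpos_nonneg)
      qed (simp add: u_on)
    qed
    finally have le0: "ip v (\<lambda>y. u y - P u y) \<le> 0" .
    \<comment> \<open>Off \<open>A \<union> S\<close> the factor \<open>u - P u\<close> is 1 and
      reproduces \<open>mean v\<close>. The two corrections pay for \<open>A\<close>, where this
      factor is 0 and \<open>v\<close> is at most 1, and for \<open>x\<close>, where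
      \<open>v\<close> is 1 and the factor is \<open>- P u x\<close>; on the rest of
      \<open>S\<close>, \<open>v\<close> is 0.\<close>
    have "mean v - (\<Sum>y\<in>V. if y \<in> A then sd y else 0)
        - (\<Sum>y\<in>V. if y = x then sd y * (1 + P u y) else 0) \<le> ip v (\<lambda>y. u y - P u y)"
      unfolding mean_def ip_def sum_subtractf[symmetric]
    proof (intro sum_mono)
      fix y assume y: "y \<in> V"
      consider "y \<in> A" | "y \<in> S" "y = x" | "y \<in> S" "y \<noteq> x" | "y \<notin> A \<union> S" by auto
      then show "sd y * v y - (if y \<in> A then sd y else 0)
          - (if y = x then sd y * (1 + P u y) else 0) \<le> sd y * v y * (u y - P u y)"
      proof cases
        case 1
        then have "y \<noteq> x" using x A by auto
        moreover have "sd y * v y \<le> sd y * 1"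
          unfolding v_def by (intro mult_left_mono hit_le_le_1 S x y sd_nonneg)
        ultimately show ?thesis using 1 u_on[of y] Pu by simp
      next
        case 2
        then show ?thesis using A u_on[of y] by (auto simp: v_def hit_le_on algebra_simps)
      next
        case 3
        then show ?thesis using A by (auto simp: v_def hit_le_on)
      next
        case 4
        then show ?thesis using x u_off[OF y] by auto
      qed
    qed
    moreover have "(\<Sum>y\<in>V. if y \<in> A then sd y else 0) = (\<Sum>y\<in>A. sd y)"
      using A by (simp add: sum.inter_restrict[symmetric] Int_absorb1)
    moreover have "(\<Sum>y\<in>V. if y = x then sd y * (1 + P u y) else 0) = sd x * (1 + P u x)"
      using x S by (subst sum.delta) auto
    ultimately show ?thesis using le0 by (simp add: v_def)
  qed
  then show "\<forall>\<^sub>F t in sequentially. mean (hit_le V E S x t)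
      \<le> sd x * (1 + P (hit_time (A \<union> S)) x) + (\<Sum>y\<in>A. sd y)"
    by (simp add: u_def)
qed simp

end

lemma (in finite_connected_graph) bdry_complement:
  "A \<subseteq> V \<Longrightarrow> bdry V E (V - A) = {x \<in> V - A. \<exists>y\<in>A. E y x}"
  by (auto simp: bdry_def)

lemma (in finite_connected_graph) bdry_nonempty:
  assumes A: "A \<subseteq> V" "A \<noteq> {}" and e: "e \<in> V" "e \<notin> A"
  shows "bdry V E (V - A) \<noteq> {}"
proof
  assume none: "bdry V E (V - A) = {}"
  obtain a where a: "a \<in> A" using A by blast
  have "reach V E k a \<subseteq> A" for k
  proof (induction k)
    case (Suc k)
    then show ?case using none E_in(2) unfolding bdry_complement[OF A(1)] by auto
  qed (use a in auto)
  moreover have "\<exists>k. e \<in> reach V E k a"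
    using conn a e A by (auto simp: connected_graph_def)
  ultimately show False using e by blast
qed

section \<open>Bounded degree: harmonic measure of order 1/|A|\<close>

locale bounded_degree_gap_graph = gap_graph +
  fixes d :: nat
  assumes deg_le: "\<And>x. x \<in> V \<Longrightarrow> deg V E x \<le> d"
begin

lemma d_ge_1: "d \<ge> 1"
proof -
  obtain x where "x \<in> V" using card_ge_2 by fastforce
  then show ?thesis using deg_pos deg_le order_trans by blast
qed

lemma sd_upper:
  assumes "x \<in> V" shows "sd x \<le> real d / real (card V)"
  unfolding sd_eq using deg_le[OF assms] card_le_total_deg card_ge_2
  by (intro frac_le) auto

lemma sd_lower:
  assumes "x \<in> V" shows "sd x \<ge> 1 / (real d * real (card V))"
proof -
  have "total_deg \<le> (\<Sum>x\<in>V. real d)"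
    unfolding total_deg_def by (intro sum_mono) (use deg_le in auto)
  then have "total_deg \<le> real d * real (card V)" by (simp add: mult.commute)
  then show ?thesis unfolding sd_eq using deg_pos[OF assms] total_deg_pos
    by (intro frac_le) auto
qed

text \<open>Uses (1 - \<gamma>)^k <= exp(- \<gamma> k) together with the lower bound 1/(d |V|) for
  \<pi>.\<close>

lemma mixing_time:
  assumes "x \<in> V"
  shows "\<exists>k. (1 - \<gamma>) ^ k \<le> sd x \<and> real k \<le> ln (real d * real (card V)) / \<gamma> + 1"
proof -
  define D where "D = real d * real (card V)"
  have D: "D \<ge> 1" unfolding D_def using d_ge_1 card_ge_2 mult_mono[of 1 "real d" 1 "real (card V)"] by simp
  define k where "k = nat \<lceil>ln D / \<gamma>\<rceil>"
  have pos: "ln D / \<gamma> \<ge> 0" using D \<gamma>_pos by simp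
  have k1: "real k \<le> ln D / \<gamma> + 1" and k2: "real k \<ge> ln D / \<gamma>"
    unfolding k_def using pos by (auto simp: of_nat_nat)
  have "(1 - \<gamma>) ^ k \<le> exp (- \<gamma>) ^ k"
    using exp_ge_add_one_self[of "- \<gamma>"] \<gamma>_le_1 by (intro power_mono) auto
  also have "\<dots> = exp (- (\<gamma> * real k))" by (simp add: exp_of_nat_mult[symmetric] mult.commute)
  also have "\<dots> \<le> exp (- ln D)" using k2 \<gamma>_pos by (simp add: field_simps)
  also have "\<dots> = 1 / D" using D by (simp add: exp_minus field_simps)
  also have "\<dots> \<le> sd x" unfolding D_def by (rule sd_lower[OF assms])
  finally show ?thesis using k1 by (auto simp: D_def)
qed

text \<open>With N = n/a, the hitting time is O(N) and \<open>sd x\<close> is at most d/n, so their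
  product is O(1/a). Smallness of \<open>A\<close> is used twice: for ln n <= 2 sqrt n <= 2 N, and
  for \<pi>(A) <= d a/n <= d/a.\<close>

lemma harm_bdry_le:
  assumes A: "A \<subseteq> V" "A \<noteq> {}" and small: "(real (card A))\<^sup>2 \<le> real (card V)"
    and x: "x \<in> bdry V E (V - A)"
  shows "harm V E (bdry V E (V - A)) x
    \<le> real d * (5 / 2 + (3 * real d + 4) / (2 * \<gamma>)) / real (card A)"
proof -
  define S where "S = bdry V E (V - A)"
  define n a where "n = real (card V)" and "a = real (card A)"
  have S: "S \<subseteq> V" "A \<inter> S = {}" "x \<in> S" and S': "A \<union> S \<subseteq> V" "A \<union> S \<noteq> {}"
    using A x by (auto simp: S_def bdry_complement)
  have xV: "x \<in> V" using S by auto
  have fA: "finite A" using A fin finite_subset by blast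
  have a1: "a \<ge> 1" using A fA unfolding a_def by (simp add: Suc_le_eq card_gt_0_iff)
  have n1: "n \<ge> 1" unfolding n_def using card_ge_2 by simp
  have dr: "real d \<ge> 1" using d_ge_1 by simp
  define N where "N = n / a"
  have a_sqrt: "a \<le> sqrt n"
    using small a1 by (intro real_le_rsqrt) (simp add: a_def n_def)
  have "a * sqrt n \<le> sqrt n * sqrt n" using a_sqrt n1 by (intro mult_right_mono) auto
  then have sqrtN: "sqrt n \<le> N" using a1 n1 by (simp add: N_def field_simps)
  then have N1: "N \<ge> 1" using n1 by (meson order_trans real_sqrt_ge_one)
  have aN: "a / n \<le> 1 / a"
    using small a1 n1 by (simp add: a_def n_def field_simps power2_eq_square)
  have "ln n = 2 * ln (sqrt n)" using n1 by (simp add: ln_sqrt)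
  moreover have "ln (sqrt n) \<le> sqrt n - 1" using n1 by (intro ln_le_minus_one) auto
  moreover have "ln (real d) \<le> real d - 1" using dr by (intro ln_le_minus_one) auto
  moreover have "ln (real d * n) = ln (real d) + ln n" using dr n1 by (simp add: ln_mult)
  moreover have "real d * 1 \<le> real d * N" using N1 by (intro mult_left_mono) auto
  ultimately have ln_le: "ln (real d * n) \<le> (real d + 2) * N"
    using sqrtN by (simp add: algebra_simps)
  \<comment> \<open>Of 3/2, one half is the rounding of \<open>k\<close> in k/2 and 1 is the first
    step away from \<open>x\<close>. The \<gamma> part adds (d + 2)/2 from the logarithm, d from the
    mean hitting time and 1 from the fluctuation. The extra 1 in the final 5/2 is \<pi>(A).\<close>
  define B where "B = (3 / 2 + (3 * real d + 4) / (2 * \<gamma>)) * N"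
  have "a * (1 / (real d * n)) = (\<Sum>y\<in>A. 1 / (real d * n))" by (simp add: a_def)
  also have "\<dots> \<le> (\<Sum>y\<in>A. sd y)"
    using A sd_lower unfolding n_def by (intro sum_mono) auto
  also have "\<dots> \<le> (\<Sum>y\<in>A \<union> S. sd y)"
    using finite_subset[OF S'(1) fin] sd_nonneg by (intro sum_mono2) auto
  finally have mass: "a / (real d * n) \<le> (\<Sum>y\<in>A \<union> S. sd y)" by simp
  have "1 / (\<gamma> * (\<Sum>y\<in>A \<union> S. sd y)) \<le> 1 / (\<gamma> * (a / (real d * n)))"
    using mass \<gamma>_pos a1 n1 dr by (intro divide_left_mono mult_left_mono mult_pos_pos) (auto intro: less_le_trans[OF _ mass])
  also have "\<dots> = real d / \<gamma> * N" using \<gamma>_pos a1 n1 dr by (simp add: N_def field_simps)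
  finally have mean_le: "1 / (\<gamma> * (\<Sum>y\<in>A \<union> S. sd y)) \<le> real d / \<gamma> * N" .
  have hit: "hit_time (A \<union> S) z \<le> B - 1" if z: "z \<in> V" for z
  proof -
    obtain k where k: "(1 - \<gamma>) ^ k \<le> sd z" "real k \<le> ln (real d * n) / \<gamma> + 1"
      using mixing_time[OF z] unfolding n_def by blast
    have "ln (real d * n) / \<gamma> \<le> (real d + 2) * N / \<gamma>"
      using ln_le \<gamma>_pos by (intro divide_right_mono) auto
    moreover have "1 / \<gamma> \<le> N / \<gamma>" using N1 \<gamma>_pos by (intro divide_right_mono) auto
    moreover have "B = 3 / 2 * N + (real d + 2) * N / \<gamma> / 2 + real d / \<gamma> * N + N / \<gamma>"
      unfolding B_def using \<gamma>_pos by (simp add: field_simps)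
    ultimately show ?thesis
      using hit_time_le[OF S' z k(1)] k(2) mean_le N1 by argo
  qed
  have "P (hit_time (A \<union> S)) x \<le> P (\<lambda>z. B - 1) x" by (rule P_mono[OF hit])
  then have Pu: "1 + P (hit_time (A \<union> S)) x \<le> B" by (simp add: P_const[OF xV])
  have B0: "B \<ge> 0" unfolding B_def using N1 \<gamma>_pos by simp
  have "harm V E S x \<le> sd x * (1 + P (hit_time (A \<union> S)) x) + (\<Sum>y\<in>A. sd y)"
  proof (rule harm_le_hit_time[OF S(1,3) A(1) S(2)])
    fix y z assume "y \<in> A" "E y z"
    then show "z \<in> A \<union> S"
      using E_in(2)[of y z] unfolding S_def bdry_complement[OF A(1)] by auto
  qed
  also have "sd x * (1 + P (hit_time (A \<union> S)) x) \<le> sd x * B"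
    using Pu sd_nonneg by (rule mult_left_mono)
  also have "\<dots> \<le> real d / n * B"
    using sd_upper[OF xV] B0 unfolding n_def by (rule mult_right_mono)
  also have "\<dots> = real d * (3 / 2 + (3 * real d + 4) / (2 * \<gamma>)) / a"
    using n1 by (simp add: B_def N_def)
  also have "(\<Sum>y\<in>A. sd y) \<le> (\<Sum>y\<in>A. real d / n)"
    using A sd_upper unfolding n_def by (intro sum_mono) auto
  also have "\<dots> = real d * (a / n)" by (simp add: a_def)
  also have "\<dots> \<le> real d * (1 / a)" using aN by (intro mult_left_mono) auto
  finally show ?thesis unfolding S_def[symmetric] a_def[symmetric]
    by (simp add: add_divide_distrib[symmetric] algebra_simps)
qed

section \<open>Ball growth and the exponential potential\<close>

lemma card_reach_le: "x \<in> V \<Longrightarrow> card (reach V E k x) \<le> (d + 1) ^ k"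
proof (induction k)
  case (Suc k)
  define R where "R = reach V E k x"
  have R: "R \<subseteq> V" "finite R" unfolding R_def
    using reach_subset[OF Suc.prems] fin finite_subset by blast+
  have "reach V E (Suc k) x = R \<union> (\<Union>y\<in>R. {z \<in> V. E y z})" unfolding R_def by auto
  then have "card (reach V E (Suc k) x) \<le> card R + card (\<Union>y\<in>R. {z \<in> V. E y z})"
    by (simp add: card_Un_le)
  also have "card (\<Union>y\<in>R. {z \<in> V. E y z}) \<le> (\<Sum>y\<in>R. card {z \<in> V. E y z})"
    by (rule card_UN_le[OF R(2)])
  also have "\<dots> \<le> (\<Sum>y\<in>R. d)"
    using R deg_le by (intro sum_mono) (auto simp: deg_def)
  also have "card R + \<dots> = (d + 1) * card R" by simp
  also have "\<dots> \<le> (d + 1) * (d + 1) ^ k" using Suc unfolding R_def by (intro mult_left_mono) auto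
  finally show ?case by simp
qed simp

lemma in_reach_gdist: "x \<in> V \<Longrightarrow> y \<in> V \<Longrightarrow> y \<in> reach V E (gdist V E x y) x"
  unfolding gdist_def by (rule LeastI_ex) (use conn in \<open>auto simp: connected_graph_def\<close>)

lemma gdist_le: "y \<in> reach V E k x \<Longrightarrow> gdist V E x y \<le> k"
  unfolding gdist_def by (rule Least_le)

lemma gdist_neighbour:
  assumes "s \<in> V" "y \<in> V" "E y x"
  shows "gdist V E s x \<le> Suc (gdist V E s y)"
  using in_reach_gdist[OF assms(1,2)] assms(3) E_in(2)[OF assms(3)] by (intro gdist_le) auto

text \<open>The ball of radius diam around \<open>s\<close> is all of \<open>V\<close>. This
  supplies the logarithmic lower bound on the distance from \<open>s\<close> to
  \<open>e\<close>.\<close>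

lemma card_le_exp_diam:
  assumes "s \<in> V"
  shows "card V \<le> (d + 1) ^ diam V E"
proof -
  have "{gdist V E x y | x y. x \<in> V \<and> y \<in> V} = (\<lambda>(x, y). gdist V E x y) ` (V \<times> V)" by auto
  then have f: "finite {gdist V E x y | x y. x \<in> V \<and> y \<in> V}" by simp
  have "V \<subseteq> reach V E (diam V E) s"
  proof
    fix y assume y: "y \<in> V"
    have "gdist V E s y \<le> diam V E"
      unfolding diam_def using f assms y by (intro Max_ge) auto
    then show "y \<in> reach V E (diam V E) s"
      using in_reach_gdist[OF assms y] reach_mono by blast
  qed
  then have "card V \<le> card (reach V E (diam V E) s)"
    using finite_subset[OF reach_subset[OF assms] fin] by (intro card_mono) auto
  also have "\<dots> \<le> (d + 1) ^ diam V E" by (rule card_reach_le[OF assms])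
  finally show ?thesis .
qed

definition potential :: "'a \<Rightarrow> 'a set \<Rightarrow> real" where
  "potential s A = (\<Sum>y\<in>A. 2 ^ gdist V E s y)"

lemma potential_nonneg: "potential s A \<ge> 0"
  by (simp add: potential_def sum_nonneg)

text \<open>Each boundary vertex is charged to its neighbours in \<open>A\<close>. A vertex of
  \<open>A\<close> receives at most \<open>d\<close> charges, each at most twice its own
  weight.\<close>

lemma sum_bdry_le_potential:
  assumes s: "s \<in> V" and A: "A \<subseteq> V"
  shows "(\<Sum>x\<in>bdry V E (V - A). 2 ^ gdist V E s x) \<le> 2 * real d * potential s A"
proof -
  define S where "S = bdry V E (V - A)"
  have fA: "finite A" using A fin finite_subset by blast
  have S: "S \<subseteq> V" "\<And>x. x \<in> S \<Longrightarrow> \<exists>y\<in>A. E y x" by (auto simp: S_def bdry_complement[OF A])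
  have "(\<Sum>x\<in>S. 2 ^ gdist V E s x) \<le> (\<Sum>x\<in>S. \<Sum>y\<in>A. if E y x then 2 ^ gdist V E s x else 0 :: real)"
  proof (intro sum_mono)
    fix x assume "x \<in> S"
    then obtain y where y: "y \<in> A" "E y x" using S by blast
    then show "2 ^ gdist V E s x \<le> (\<Sum>y\<in>A. if E y x then 2 ^ gdist V E s x else 0 :: real)"
      using member_le_sum[of y A "\<lambda>y. if E y x then 2 ^ gdist V E s x else 0 :: real"] fA by auto
  qed
  also have "\<dots> = (\<Sum>y\<in>A. \<Sum>x\<in>S. if E y x then 2 ^ gdist V E s x else 0)"
    by (rule sum.swap)
  also have "\<dots> \<le> (\<Sum>y\<in>A. 2 * real d * 2 ^ gdist V E s y)"
  proof (intro sum_mono)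
    fix y assume "y \<in> A"
    then have y: "y \<in> V" using A by blast
    have "(\<Sum>x\<in>S. if E y x then 2 ^ gdist V E s x else 0)
        \<le> (\<Sum>x\<in>S. if E y x then 2 ^ Suc (gdist V E s y) else 0 :: real)"
    proof (intro sum_mono)
      fix x
      show "(if E y x then 2 ^ gdist V E s x else 0) \<le> (if E y x then 2 ^ Suc (gdist V E s y) else 0 :: real)"
        using power_increasing[OF gdist_neighbour[OF s y], of x "2 :: real"] by simp
    qed
    also have "\<dots> \<le> (\<Sum>x\<in>V. if E y x then 2 ^ Suc (gdist V E s y) else 0)"
      using S by (intro sum_mono2) auto
    also have "\<dots> = real (deg V E y) * 2 ^ Suc (gdist V E s y)"
      unfolding sum.inter_filter[OF fin, symmetric] by (simp add: deg_def)
    also have "\<dots> \<le> real d * 2 ^ Suc (gdist V E s y)"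
      using deg_le[OF y] by (intro mult_right_mono) auto
    finally show "(\<Sum>x\<in>S. if E y x then 2 ^ gdist V E s x else 0) \<le> 2 * real d * 2 ^ gdist V E s y"
      by simp
  qed
  finally show ?thesis by (simp add: S_def potential_def sum_distrib_left)
qed

section \<open>The failure probability of DLA\<close>

lemma dla_prob_le_1:
  assumes "e \<in> V" "A \<subseteq> V" "A \<noteq> {}"
  shows "dla_prob V E e Q k A \<le> 1"
  using assms(2,3)
proof (induction k arbitrary: A)
  case (Suc k)
  show ?case
  proof (cases "e \<in> A")
    case False
    let ?S = "bdry V E (V - A)"
    have S: "?S \<subseteq> V" "?S \<noteq> {}"
      using bdry_nonempty[OF Suc.prems assms(1) False] by (auto simp: bdry_def)
    have "dla_prob V E e Q (Suc k) A = (\<Sum>x\<in>?S. harm V E ?S x * dla_prob V E e Q k (insert x A))"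
      using False by simp
    also have "\<dots> \<le> (\<Sum>x\<in>?S. harm V E ?S x * 1)"
      using S Suc by (intro sum_mono mult_left_mono harm_nonneg) auto
    finally show ?thesis by (simp add: sum_harm[OF S])
  qed simp
qed simp

text \<open>Terminal case of the supermartingale bound: an aggregate that stops too small fails with
  probability 1, and the term of \<open>e\<close> alone already makes the bound at least 1.\<close>

lemma one_le_potential_bound:
  assumes A: "A \<subseteq> V" "e \<in> A" and small: "real (card A) < X"
  shows "1 \<le> potential s A * (X / real (card A)) ^ p / 2 ^ gdist V E s e"
proof -
  have fA: "finite A" using A fin finite_subset by blast
  have c: "real (card A) > 0" using A fA by (auto simp: card_gt_0_iff)
  have "2 ^ gdist V E s e * 1 \<le> potential s A * (X / real (card A)) ^ p"
  proof (rule mult_mono)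
    show "2 ^ gdist V E s e \<le> potential s A"
      unfolding potential_def using A fA by (intro member_le_sum) auto
    show "1 \<le> (X / real (card A)) ^ p" using small c by (intro one_le_power) simp
  qed (auto simp: potential_nonneg)
  then show ?thesis by simp
qed

text \<open>\<open>potential s A\<close> grows by a factor of at most \<open>1 + p / |A|\<close> on average in one step, so
  \<open>potential s A * (X / |A|)^p\<close> is a supermartingale.\<close>

lemma dla_prob_small_le:
  fixes C X :: real
  assumes s: "s \<in> V" and e: "e \<in> V" and p: "2 * real d * C \<le> real p" and C: "C \<ge> 0"
    and harm_le: "\<And>A x. A \<subseteq> V \<Longrightarrow> A \<noteq> {} \<Longrightarrow> real (card A) < X \<Longrightarrow> x \<in> bdry V E (V - A)
        \<Longrightarrow> harm V E (bdry V E (V - A)) x \<le> C / real (card A)"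
    and A: "A \<subseteq> V" "A \<noteq> {}" "card V \<le> k + card A"
  shows "1 - dla_prob V E e (\<lambda>A. real (card A) \<ge> X) k A
    \<le> (if real (card A) \<ge> X then 0 else potential s A * (X / real (card A)) ^ p / 2 ^ gdist V E s e)"
  using A
proof (induction k arbitrary: A)
  case 0
  \<comment> \<open>The budget \<open>k\<close> runs out only when the aggregate is everything and
    hence contains \<open>e\<close>, so an unfinished process adds nothing to the failure
    probability.\<close>
  then have "A = V" using card_seteq[OF fin, of A] by simp
  then show ?case using one_le_potential_bound[of A e X s p] e by auto
next
  case (Suc k)
  let ?Q = "\<lambda>A. real (card A) \<ge> X"
  show ?case
  proof (cases "e \<in> A")
    case True
    then show ?thesis using one_le_potential_bound[OF Suc.prems(1) True, of X s p] by auto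
  next
    case False
    let ?S = "bdry V E (V - A)"
    define a where "a = real (card A)"
    define G where "G = (2 :: real) ^ gdist V E s e"
    have G: "G > 0" by (simp add: G_def)
    have fA: "finite A" using Suc.prems fin finite_subset by blast
    have a: "a > 0" unfolding a_def using Suc.prems fA by (simp add: card_gt_0_iff)
    have S: "?S \<subseteq> V" "?S \<noteq> {}" "\<And>x. x \<in> ?S \<Longrightarrow> x \<notin> A"
      using bdry_nonempty[OF Suc.prems(1,2) e False] by (auto simp: bdry_def)
    have IH: "1 - dla_prob V E e ?Q k (insert x A)
        \<le> (if a + 1 \<ge> X then 0 else potential s (insert x A) * (X / (a + 1)) ^ p / G)" if "x \<in> ?S" for x
      using Suc.IH[of "insert x A"] Suc.prems S that fA
      by (auto simp: a_def G_def add.commute subset_iff)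
    have sum_eq: "1 - dla_prob V E e ?Q (Suc k) A
        = (\<Sum>x\<in>?S. harm V E ?S x * (1 - dla_prob V E e ?Q k (insert x A)))"
      using False sum_harm[OF S(1,2)] by (simp add: right_diff_distrib sum_subtractf)
    show ?thesis
    proof (cases "a \<ge> X")
      case True
      have "(\<Sum>x\<in>?S. harm V E ?S x * (1 - dla_prob V E e ?Q k (insert x A))) \<le> 0"
      proof (rule sum_nonpos)
        fix x assume x: "x \<in> ?S"
        have "1 - dla_prob V E e ?Q k (insert x A) \<le> 0" using IH[OF x] True by simp
        then show "harm V E ?S x * (1 - dla_prob V E e ?Q k (insert x A)) \<le> 0"
          using harm_nonneg[OF S(1) x] by (rule mult_nonneg_nonpos[rotated])
      qed
      then show ?thesis using True unfolding sum_eq by (simp add: a_def)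
    next
      case small: False
      define M where "M = (X / (a + 1)) ^ p / G"
      have X: "X > 0" using small a by simp
      have M: "M \<ge> 0" unfolding M_def using X a G by simp
      \<comment> \<open>Bernoulli replaces the growth factor by (1 + 1/a)^p, which is exactly the
        ratio of (X/a)^p to (X/(a + 1))^p.\<close>
      have "0 \<le> 1 / a" using a by simp
      then have "- 1 \<le> 1 / a" by linarith
      from Bernoulli_inequality[OF this, of p]
      have bernoulli: "1 + real p / a \<le> (1 + 1 / a) ^ p" by simp
      have "(\<Sum>x\<in>?S. harm V E ?S x * (1 - dla_prob V E e ?Q k (insert x A)))
          \<le> (\<Sum>x\<in>?S. harm V E ?S x * ((potential s A + 2 ^ gdist V E s x) * M))"
      proof (intro sum_mono mult_left_mono harm_nonneg S)
        fix x assume x: "x \<in> ?S"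
        have "potential s (insert x A) = potential s A + 2 ^ gdist V E s x"
          unfolding potential_def using S(3)[OF x] fA by simp
        then show "1 - dla_prob V E e ?Q k (insert x A) \<le> (potential s A + 2 ^ gdist V E s x) * M"
          using IH[OF x] mult_nonneg_nonneg[OF potential_nonneg[of s "insert x A"] M]
          by (auto simp: M_def split: if_splits)
      qed
      also have "\<dots> = (\<Sum>x\<in>?S. (harm V E ?S x * potential s A + harm V E ?S x * 2 ^ gdist V E s x) * M)"
        by (intro sum.cong) (auto simp: algebra_simps)
      also have "\<dots> = (potential s A + (\<Sum>x\<in>?S. harm V E ?S x * 2 ^ gdist V E s x)) * M"
        unfolding sum_distrib_right[symmetric] sum.distrib sum_harm[OF S(1,2)] by simp
      also have "\<dots> \<le> (potential s A + (\<Sum>x\<in>?S. C / a * 2 ^ gdist V E s x)) * M"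
        unfolding a_def using Suc.prems small M
        by (intro mult_right_mono add_left_mono sum_mono harm_le) (auto simp: a_def)
      also have "\<dots> \<le> (potential s A + C / a * (2 * real d * potential s A)) * M"
        unfolding sum_distrib_left[symmetric] using C a M
        by (intro mult_right_mono add_left_mono mult_left_mono sum_bdry_le_potential s Suc.prems) auto
      also have "\<dots> = potential s A * (1 + 2 * real d * C / a) * M"
        by (simp add: algebra_simps)
      also have "\<dots> \<le> potential s A * (1 + real p / a) * M"
        using p a M potential_nonneg
        by (intro mult_right_mono mult_left_mono add_left_mono divide_right_mono) auto
      also have "\<dots> \<le> potential s A * (1 + 1 / a) ^ p * M"
        using bernoulli M potential_nonneg
        by (intro mult_right_mono mult_left_mono) auto
      also have "\<dots> = potential s A * ((1 + 1 / a) * (X / (a + 1))) ^ p / G"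
        unfolding M_def power_mult_distrib by (simp only: mult.assoc times_divide_eq_right)
      also have "(1 + 1 / a) * (X / (a + 1)) = X / a"
        using a by (simp add: divide_simps)
      finally show ?thesis using small unfolding sum_eq by (simp add: a_def G_def)
    qed
  qed
qed

text \<open>The threshold is X = n^c. Since c <= 1/2, every aggregate below it satisfies |A|^2 <= n.
  From \<open>{s}\<close>, which has potential 1 and size 1, the failure bound is n^(cp) /
  2^diam.\<close>

lemma dla_final_prob_ge:
  fixes c :: real
  assumes s: "s \<in> V" and e: "e \<in> V" and far: "gdist V E s e = diam V E"
    and p: "2 * real d * (real d * (5 / 2 + (3 * real d + 4) / (2 * \<gamma>))) \<le> real p"
    and c: "0 < c" "c \<le> 1 / 2" "c * real p \<le> \<beta> / 2" and \<beta>: "\<beta> = ln 2 / ln (real d + 1)"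
  shows "1 - real (card V) powr (- \<beta> / 2)
    \<le> dla_final_prob V E s e (\<lambda>A. real (card A) \<ge> real (card V) powr c)"
proof -
  define n where "n = real (card V)"
  define C where "C = real d * (5 / 2 + (3 * real d + 4) / (2 * \<gamma>))"
  have n: "n \<ge> 1" unfolding n_def using card_ge_2 by simp
  have C: "C \<ge> 0" unfolding C_def using \<gamma>_pos by simp
  have "1 - dla_prob V E e (\<lambda>A. real (card A) \<ge> n powr c) (card V) {s}
    \<le> (if real (card {s}) \<ge> n powr c then 0
       else potential s {s} * (n powr c / real (card {s})) ^ p / 2 ^ gdist V E s e)"
  proof (rule dla_prob_small_le[OF s e _ C])
    show "2 * real d * C \<le> real p" using p by (simp add: C_def)
    fix A x assume A: "A \<subseteq> V" "A \<noteq> {}" "real (card A) < n powr c" "x \<in> bdry V E (V - A)"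
    have "(real (card A))\<^sup>2 \<le> (n powr c)\<^sup>2" using A(3) by (intro power_mono) auto
    also have "\<dots> = n powr (2 * c)" using n by (simp add: powr_power)
    also have "\<dots> \<le> n powr 1" using n c by (intro powr_mono) auto
    finally have "(real (card A))\<^sup>2 \<le> real (card V)" using n by (simp add: n_def)
    then show "harm V E (bdry V E (V - A)) x \<le> C / real (card A)"
      unfolding C_def by (rule harm_bdry_le[OF A(1,2) _ A(4)])
  qed (use s in auto)
  also have "\<dots> \<le> potential s {s} * (n powr c / real (card {s})) ^ p / 2 ^ gdist V E s e"
    by (simp add: potential_nonneg)
  also have "\<dots> = (n powr c) ^ p / 2 ^ diam V E"
  proof -
    have "gdist V E s s = 0" using gdist_le[of s 0 s] by simp
    then show ?thesis by (simp add: potential_def far)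
  qed
  also have "\<dots> = n powr (c * real p) / 2 ^ diam V E"
    using n by (simp add: powr_power mult.commute)
  also have "\<dots> \<le> n powr (\<beta> / 2) / n powr \<beta>"
  proof (rule frac_le)
    show "n powr (c * real p) \<le> n powr (\<beta> / 2)" using n c by (intro powr_mono) auto
    have l: "ln (real d + 1) > 0" using d_ge_1 by (intro ln_gt_zero) simp
    have "n \<le> real ((d + 1) ^ diam V E)" unfolding n_def using card_le_exp_diam[OF s] by (simp only: of_nat_le_iff)
    then have "ln n \<le> ln ((real d + 1) ^ diam V E)" using n by (simp add: add.commute)
    also have "\<dots> = real (diam V E) * ln (real d + 1)" by (simp add: ln_realpow)
    finally have "\<beta> * ln n \<le> \<beta> * (real (diam V E) * ln (real d + 1))"
      using l by (intro mult_left_mono) (auto simp: \<beta>)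
    also have "\<dots> = real (diam V E) * ln 2" using l by (simp add: \<beta>)
    finally have "exp (\<beta> * ln n) \<le> exp (real (diam V E) * ln 2)" by simp
    then show "n powr \<beta> \<le> 2 ^ diam V E"
      using n by (simp add: powr_def exp_of_nat_mult)
  qed (use n in auto)
  also have "\<dots> = n powr (- \<beta> / 2)"
    by (simp add: powr_diff[symmetric])
  finally show ?thesis unfolding dla_final_prob_def n_def by linarith
qed

end

theorem mainTheorem9:
  fixes V :: "nat \<Rightarrow> 'a set" and E :: "nat \<Rightarrow> 'a \<Rightarrow> 'a \<Rightarrow> bool"
    and s e :: "nat \<Rightarrow> 'a" and d :: nat and \<gamma> :: real
  assumes d: "d \<ge> 1"
    and graph: "\<And>n. simple_graph (V n) (E n)"
    and conn: "\<And>n. connected_graph (V n) (E n)"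
    and size: "filterlim (\<lambda>n. card (V n)) at_top sequentially"
    and maxdeg: "\<And>n x. x \<in> V n \<Longrightarrow> deg (V n) (E n) x \<le> d"
    and gap_pos: "\<gamma> > 0"
    and gap: "\<And>n. spectral_gap (V n) (E n) \<ge> \<gamma>"
    and se: "\<And>n. s n \<in> V n \<and> e n \<in> V n"
    and diam: "\<And>n. gdist (V n) (E n) (s n) (e n) = diam (V n) (E n)"
  shows "\<exists>c>0. (\<lambda>n. dla_final_prob (V n) (E n) (s n) (e n)
                  (\<lambda>A. real (card A) \<ge> real (card (V n)) powr c)) \<longlonglongrightarrow> 1"
proof -
  \<comment> \<open>Capping at 1 keeps a valid lower bound for the gap and makes the powers of 1 -
    \<gamma>' nonnegative.\<close>
  define \<gamma>' where "\<gamma>' = min \<gamma> 1"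
  define C where "C = 2 * real d * (real d * (5 / 2 + (3 * real d + 4) / (2 * \<gamma>')))"
  define p where "p = nat \<lceil>C\<rceil>"
  define \<beta> where "\<beta> = ln 2 / ln (real d + 1)"
  \<comment> \<open>The first entry keeps |A|^2 <= |G| below the threshold; the second gives cp <=
    \<beta>/2, with \<open>real p + 1\<close> as a visibly positive denominator.\<close>
  define c where "c = min (1 / 2) (\<beta> / (2 * (real p + 1)))"
  have \<beta>: "\<beta> > 0" unfolding \<beta>_def using d by simp
  have p: "C \<le> real p" unfolding p_def by (rule real_nat_ceiling_ge)
  have c: "c > 0" unfolding c_def using \<beta> by simp
  have c_le: "c \<le> 1 / 2" unfolding c_def by (rule min.cobounded1)
  have "c * real p \<le> \<beta> / (2 * (real p + 1)) * (real p + 1)"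
    unfolding c_def using \<beta> by (intro mult_mono) auto
  also have "\<dots> = \<beta> / 2"
    using times_divide_times_eq[of \<beta> 2 "real p + 1" "real p + 1"] by simp
  finally have cp: "c * real p \<le> \<beta> / 2" .
  let ?f = "\<lambda>n. dla_final_prob (V n) (E n) (s n) (e n)
                  (\<lambda>A. real (card A) \<ge> real (card (V n)) powr c)"
  \<comment> \<open>Finitely many graphs may be single vertices; the limit ignores them.\<close>
  have loc: "bounded_degree_gap_graph (V n) (E n) \<gamma>' d" if "card (V n) \<ge> 2" for n
    using that graph conn maxdeg gap_pos gap[of n] by unfold_locales (auto simp: \<gamma>'_def)
  have ev: "\<forall>\<^sub>F n in sequentially. card (V n) \<ge> 2"
    using size by (simp add: filterlim_at_top)
  have "(\<lambda>n. real (card (V n)) powr (- \<beta> / 2)) \<longlonglongrightarrow> 0"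
    using \<beta> by (intro tendsto_neg_powr filterlim_compose[OF filterlim_real_sequentially size]) auto
  then have lim: "(\<lambda>n. 1 - real (card (V n)) powr (- \<beta> / 2)) \<longlonglongrightarrow> 1"
    by (auto intro: tendsto_eq_intros)
  have lower: "\<forall>\<^sub>F n in sequentially. 1 - real (card (V n)) powr (- \<beta> / 2) \<le> ?f n"
    using ev
  proof eventually_elim
    case (elim n)
    interpret bounded_degree_gap_graph "V n" "E n" \<gamma>' d by (rule loc[OF elim])
    show ?case
      by (rule dla_final_prob_ge[OF _ _ diam _ c c_le cp \<beta>_def]) (use se p in \<open>auto simp: C_def\<close>)
  qed
  have upper: "\<forall>\<^sub>F n in sequentially. ?f n \<le> 1"
    using ev
  proof eventually_elim
    case (elim n)
    interpret bounded_degree_gap_graph "V n" "E n" \<gamma>' d by (rule loc[OF elim])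
    show ?case unfolding dla_final_prob_def using se by (intro dla_prob_le_1) auto
  qed
  show ?thesis
    using c tendsto_sandwich[OF lower upper lim tendsto_const] by blast
qed

end
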